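(* Let $q>1$ be real. Then $\mathcal{E}_q(x)=E_q(x)$ on the sector $\{|\arg x|<2\pi\}$ of the Riemann surface of the logarithm, and, for every $\lambda\in\mathbb{C}^*\smallsetminus(-q^{\mathbb{Z}})$, $\mathcal{E}_q^{[\lambda]}(x)=E_q^{[\lambda]}(x)$ for all $x\in\mathbb{C}^*\smallsetminus(p-1)\lambda q^{\mathbb{Z}}$.
   Context: Let $p=q^{-1}\in(0,1)$; $[n]_q=\frac{q^n-1}{q-1}$, $[n]_q^!=[n]_q\cdots[1]_q$, $[0]_q^!=1$ (and the same with $p$ in place of $q$); $e_q(x)=\sum_{n\ge0}\frac{x^n}{[n]_q^!}=\prod_{k\ge0}(1+(1-p)p^kx)$; $\theta_p(x)=\sum_{n\in\mathbb{Z}}p^{n(n-1)/2}x^n$; Jackson integral $\int_{\alpha p^{\mathbb{Z}}}f(\xi)\,d_p\xi=(1-p)\alpha\sum_{n\in\mathbb{Z}}f(p^n\alpha)p^n$. Let $\psi(\xi)=\frac1{1+\xi}$ and let $\phi(\xi)$ be the analytic continuation to $\mathbb{C}\smallsetminus(p-1)q^{\mathbb{N}}$ of $\sum_{n\ge0}(-1)^n[n]_p^!\xi^n$ (these are the two $q$-Borel transforms of the $q$-Euler series $\sum_{n\ge0}(-1)^n[n]_q^!x^{n+1}$). For $d\in(-\pi,\pi)$ and $\arg x\in(d-\pi,d+\pi)$ put $$\mathcal{E}_q^d(x)=\frac{q-1}{\ln q}\int_0^{e^{id}\infty}\frac{\psi(\xi)}{e_q(q\xi/x)}\,d\xi,\qquad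 E_q^d(x)=\frac{q}{\ln q}\int_0^{e^{id}\infty}\frac{\phi(\xi)}{\theta_p(q\xi/x)}\,d\xi .$$ As $d$ varies in $(-\pi,\pi)$ these glue to analytic functions $\mathcal{E}_q$, $E_q$ on the sector $\{|\arg x|<2\pi\}$ of the Riemann surface of the logarithm. For $\lambda\in\mathbb{C}^*\smallsetminus(-q^{\mathbb{Z}})$ and $x\in\mathbb{C}^*\smallsetminus(p-1)\lambda q^{\mathbb{Z}}$ put $$\mathcal{E}_q^{[\lambda]}(x)=q\int_{\lambda p^{\mathbb{Z}}}\frac{\psi(\xi)}{e_q(q\xi/x)}\,d_p\xi,\qquad E_q^{[\lambda]}(x)=\frac{q}{1-p}\int_{(1-p)\lambda p^{\mathbb{Z}}}\frac{\phi(\xi)}{\theta_p(q\xi/x)}\,d_p\xi .$$ *)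

theory Defs
  imports "HOL-Analysis.Analysis"
begin

text \<open>
  Throughout, \<open>q > 1\<close> is real and \<open>p = 1/q\<close>. The functions \<open>qnum\<close> and \<open>qfact\<close> take the base
  as an argument, since both bases \<open>q\<close> and \<open>p\<close> occur.
\<close>

definition qnum :: "real \<Rightarrow> nat \<Rightarrow> real" where
  "qnum q n = (q ^ n - 1) / (q - 1)"

definition qfact :: "real \<Rightarrow> nat \<Rightarrow> real" where
  "qfact q n = (\<Prod>k=1..n. qnum q k)"

definition qexp :: "real \<Rightarrow> complex \<Rightarrow> complex" where
  "qexp q x = (\<Sum>n. x ^ n / of_real (qfact q n))"

text \<open>The integer division is exact, as \<open>n * (n - 1)\<close> is even.\<close>

definition theta :: "real \<Rightarrow> complex \<Rightarrow> complex" where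
  "theta p x = (\<Sum>\<^sub>\<infinity>n::int. of_real (p powi (n * (n - 1) div 2)) * x powi n)"

definition jackson_integral :: "real \<Rightarrow> complex \<Rightarrow> (complex \<Rightarrow> complex) \<Rightarrow> complex" where
  "jackson_integral p \<alpha> f =
     of_real (1 - p) * \<alpha> * (\<Sum>\<^sub>\<infinity>n::int. f (of_real (p powi n) * \<alpha>) * of_real (p powi n))"

text \<open>The integral of \<open>f\<close> from \<open>0\<close> to infinity along the ray with argument \<open>d\<close>,
  parametrised by \<open>\<xi> = t e\<^sup>i\<^sup>d\<close>.\<close>

definition ray_integral :: "real \<Rightarrow> (complex \<Rightarrow> complex) \<Rightarrow> complex" where
  "ray_integral d f = (LINT t:{0<..}|lborel. f (of_real t * cis d) * cis d)"

definition psi :: "complex \<Rightarrow> complex" where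
  "psi \<xi> = 1 / (1 + \<xi>)"

definition phi_poles :: "real \<Rightarrow> complex set" where
  "phi_poles q = {of_real ((1/q - 1) * q ^ k) | k::nat. True}"

text \<open>
  The analytic continuation of the series with coefficients \<open>(-1)\<^sup>n [n]\<^sub>p!\<close>, whose disc of
  convergence has radius \<open>1 - p\<close>. It is unique on the connected open set \<open>- phi_poles q\<close>, which
  contains this disc; the values at the poles themselves are irrelevant.
\<close>

definition phi :: "real \<Rightarrow> complex \<Rightarrow> complex" where
  "phi q = (SOME f. f holomorphic_on (- phi_poles q) \<and>
      (\<forall>\<xi>. norm \<xi> < 1 - 1/q \<longrightarrow>
         (\<lambda>n. (-1) ^ n * of_real (qfact (1/q) n) * \<xi> ^ n) sums f \<xi>))"

definition Euler_exp_dir :: "real \<Rightarrow> real \<Rightarrow> complex \<Rightarrow> complex" where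
  "Euler_exp_dir q d x =
     of_real ((q - 1) / ln q) * ray_integral d (\<lambda>\<xi>. psi \<xi> / qexp q (of_real q * \<xi> / x))"

definition Euler_theta_dir :: "real \<Rightarrow> real \<Rightarrow> complex \<Rightarrow> complex" where
  "Euler_theta_dir q d x =
     of_real (q / ln q) * ray_integral d (\<lambda>\<xi>. phi q \<xi> / theta (1/q) (of_real q * \<xi> / x))"

text \<open>
  A point \<open>x\<close> of the Riemann surface of the logarithm is given by its logarithm \<open>w\<close>: it lies above
  \<open>exp w\<close>, and \<open>arg x = Im w\<close>. For a family \<open>F d\<close> of functions, the \<open>d\<close>-th one being considered for
  \<open>arg x \<in> (d - \<pi>, d + \<pi>)\<close>, the glued function takes at \<open>x\<close> the common value of all \<open>F d\<close> with
  \<open>d \<in> (-\<pi>, \<pi>)\<close> that are defined at \<open>x\<close>. Such \<open>d\<close> exist exactly if \<open>\<bar>Im w\<bar> < 2\<pi>\<close>.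
\<close>

definition glue :: "(real \<Rightarrow> complex \<Rightarrow> complex) \<Rightarrow> complex \<Rightarrow> complex" where
  "glue F w =
     (THE v. \<forall>d\<in>{-pi<..<pi}. Im w \<in> {d - pi<..<d + pi} \<longrightarrow> F d (exp w) = v)"

definition Euler_exp :: "real \<Rightarrow> complex \<Rightarrow> complex" where
  "Euler_exp q = glue (Euler_exp_dir q)"

definition Euler_theta :: "real \<Rightarrow> complex \<Rightarrow> complex" where
  "Euler_theta q = glue (Euler_theta_dir q)"

definition Euler_exp_disc :: "real \<Rightarrow> complex \<Rightarrow> complex \<Rightarrow> complex" where
  "Euler_exp_disc q l x =
     of_real q * jackson_integral (1/q) l (\<lambda>\<xi>. psi \<xi> / qexp q (of_real q * \<xi> / x))"

definition Euler_theta_disc :: "real \<Rightarrow> complex \<Rightarrow> complex \<Rightarrow> complex" where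
  "Euler_theta_disc q l x =
     of_real (q / (1 - 1/q)) * jackson_integral (1/q) (of_real (1 - 1/q) * l)
       (\<lambda>\<xi>. phi q \<xi> / theta (1/q) (of_real q * \<xi> / x))"

end

theory Submission
  imports Defs "HOL-Complex_Analysis.Complex_Analysis" "HOL-Probability.Sinc_Integral"
begin

text \<open>
  Write \<open>e\<close> for Euler's entire series \<open>eul\<close>, so that \<open>e\<^sub>q(x) = e((1 - p) x)\<close>. Expanding
  \<open>(p;p)\<^sub>n = (p;p)\<^sub>\<infinity> \<Sum>\<^sub>m p\<^sup>m\<^sup>(\<^sup>n\<^sup>+\<^sup>1\<^sup>) / (p;p)\<^sub>m\<close> in the series of \<open>\<phi>\<close> gives
  \<open>\<phi>(\<xi>) = (p;p)\<^sub>\<infinity> \<Sum>\<^sub>m p\<^sup>m / (p;p)\<^sub>m \<cdot> \<psi>(p\<^sup>m \<xi> / (1 - p))\<close>, which also provides the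
  continuation. On the other hand \<open>\<theta>\<^sub>p(p\<^sup>-\<^sup>m b) = p\<^sup>-\<^sup>m\<^sup>(\<^sup>m\<^sup>+\<^sup>1\<^sup>)\<^sup>/\<^sup>2 b\<^sup>m \<theta>\<^sub>p(b)\<close> and the triple product
  \<open>\<theta>\<^sub>p(b) = (p;p)\<^sub>\<infinity> e(b) e(p/b)\<close> give
  \<open>(p;p)\<^sub>\<infinity> \<Sum>\<^sub>m 1 / ((p;p)\<^sub>m \<theta>\<^sub>p(p\<^sup>-\<^sup>m b)) = 1 / e(b)\<close>. Hence inserting the first expansion into the
  theta-integral, rescaling the \<open>m\<close>-th term by \<open>p\<^sup>-\<^sup>m\<close> and summing over \<open>m\<close> inside the integral
  turns it into the \<open>e\<^sub>q\<close>-integral, for the Jackson as well as for the ray integral.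
\<close>

subsection \<open>Euler's two q-exponential series\<close>

text \<open>The ratio enters in product form, so vanishing terms (as at \<open>b = 0\<close>) cause
  no division by zero.\<close>

lemma summable_norm_ratio_limit:
  fixes a :: "nat \<Rightarrow> 'a::banach"
  assumes "\<And>n. norm (a (Suc n)) = r n * norm (a n)" and "r \<longlonglongrightarrow> l" and "l < 1"
  shows "summable (\<lambda>n. norm (a n))"
proof -
  obtain c where c: "l < c" "c < 1"
    using dense[OF \<open>l < 1\<close>] by blast
  have "eventually (\<lambda>n. r n < c) sequentially"
    using order_tendstoD(2)[OF assms(2) c(1)] .
  then obtain N where N: "\<And>n. n \<ge> N \<Longrightarrow> r n < c"
    by (auto simp: eventually_sequentially)
  show ?thesis
  proof (rule summable_ratio_test[OF c(2)])
    show "norm (norm (a (Suc n))) \<le> c * norm (norm (a n))" if "n \<ge> N" for n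
      using mult_right_mono[OF less_imp_le[OF N[OF that]], of "norm (a n)"] by (simp add: assms(1)[symmetric])
  qed
qed

lemma norm_of_real_mult_power: "0 \<le> c \<Longrightarrow> norm (of_real c * b ^ n :: complex) = c * norm b ^ n"
  by (simp add: norm_mult norm_power)

lemma diff_scaled_power:
  "c * b ^ k - c * (of_real p * b) ^ k = c * of_real (1 - p ^ k) * (b :: complex) ^ k"
  by (simp add: power_mult_distrib algebra_simps)

text \<open>The points \<open>p^n z\<close> tend to 0, so continuity carries the constant value
  along this orbit over to 0. This turns functional equations relating \<open>z\<close> and
  \<open>p z\<close> into identities.\<close>

lemma tendsto_unique_scaling:
  fixes f :: "complex \<Rightarrow> 'a::t2_space"
  assumes "isCont f 0" and "0 < p" "p < 1" and "\<And>n. f (of_real p ^ n * z) = c"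
  shows "f 0 = c"
proof -
  have "(\<lambda>n. (of_real p :: complex) ^ n) \<longlonglongrightarrow> 0"
    using assms by (intro LIMSEQ_power_zero) auto
  then have "(\<lambda>n. of_real p ^ n * z) \<longlonglongrightarrow> 0"
    by (auto intro: tendsto_eq_intros)
  then have "(\<lambda>n. f (of_real p ^ n * z)) \<longlonglongrightarrow> f 0"
    by (rule isCont_tendsto_compose[OF assms(1)])
  then show ?thesis
    using assms(4) LIMSEQ_unique tendsto_const by fastforce
qed

text \<open>All computations run in base \<open>p\<close>, with \<open>q\<close> written as
  \<open>1 / p\<close>; the final theorem interprets the locale at \<open>1 / q\<close>.\<close>

locale q_base =
  fixes p :: real
  assumes p_pos: "0 < p" and p_less_1: "p < 1"
begin

text \<open>The q-Pochhammer symbol \<open>(p;p)_n\<close>.\<close>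

definition poch :: "nat \<Rightarrow> real" where
  "poch n = (\<Prod>k=1..n. 1 - p ^ k)"

text \<open>Integer indices let one weight serve both the bilateral series \<open>theta\<close> and,
  at \<open>int n\<close>, the series \<open>eul\<close>.\<close>

definition gauss :: "int \<Rightarrow> real" where
  "gauss n = p powi (n * (n - 1) div 2)"

definition eul :: "complex \<Rightarrow> complex" where
  "eul b = (\<Sum>n. of_real (gauss (int n) / poch n) * b ^ n)"

text \<open>On the open unit disc this is the reciprocal of \<open>eul (- z)\<close>, that is,
  \<open>1 / (z;p)_inf\<close>.\<close>

definition eul_inv :: "complex \<Rightarrow> complex" where
  "eul_inv z = (\<Sum>n. of_real (1 / poch n) * z ^ n)"

text \<open>This is \<open>(p;p)\<^sub>\<infinity>\<close>, because \<open>eul b\<close> is the product of all \<open>1 + p\<^sup>k b\<close>.\<close>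

definition poch_inf :: complex where
  "poch_inf = eul (- of_real p)"

lemma p_nz [simp]: "p \<noteq> 0"
  using p_pos by simp

lemma p_power_less_1: "0 < k \<Longrightarrow> p ^ k < 1"
  using p_pos p_less_1 by (simp add: power_less_one_iff)

lemma poch_0 [simp]: "poch 0 = 1"
  by (simp add: poch_def)

lemma poch_Suc: "poch (Suc n) = poch n * (1 - p ^ Suc n)"
  by (simp add: poch_def)

lemma poch_pos: "0 < poch n"
  unfolding poch_def by (intro prod_pos) (auto simp: p_power_less_1)

lemma poch_nz [simp]: "poch n \<noteq> 0"
  using poch_pos[of n] by simp

lemma gauss_pos: "0 < gauss n"
  by (simp add: gauss_def p_pos)

lemma gauss_nz [simp]: "gauss n \<noteq> 0"
  using gauss_pos[of n] by simp

lemma gauss_0 [simp]: "gauss 0 = 1"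
  by (simp add: gauss_def)

text \<open>The exponent is quadratic with polar form \<open>m n\<close>. This rule is behind
  \<open>theta_scale\<close> and the shift of indices in \<open>theta_mult_eul_inv\<close>.\<close>

lemma gauss_add: "gauss (m + n) = gauss m * gauss n * p powi (m * n)"
proof -
  have "(m + n) * (m + n - 1) = m * (m - 1) + n * (n - 1) + 2 * (m * n)"
    by (simp add: algebra_simps)
  then have "(m + n) * (m + n - 1) div 2 = m * (m - 1) div 2 + n * (n - 1) div 2 + m * n"
    by (simp add: div_plus_div_distrib_dvd_left)
  then show ?thesis
    by (simp add: gauss_def power_int_add)
qed

lemma gauss_1 [simp]: "gauss 1 = 1"
  by (simp add: gauss_def)

lemma gauss_Suc: "gauss (n + 1) = gauss n * p powi n"
  using gauss_add[of n 1] by simp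

lemma gauss_minus: "gauss (- n) = gauss n * p powi n"
proof -
  have "gauss (- n) = gauss (n + 1)"
    unfolding gauss_def by (rule arg_cong[where f="\<lambda>k. p powi (k div 2)"]) (simp add: algebra_simps)
  then show ?thesis by (simp add: gauss_Suc)
qed

lemma p_power_tendsto: "(\<lambda>n. p ^ Suc n) \<longlonglongrightarrow> 0"
  using p_pos p_less_1 by (intro LIMSEQ_Suc LIMSEQ_power_zero) auto

lemma summable_norm_eul: "summable (\<lambda>n. norm (of_real (gauss (int n) / poch n) * b ^ n :: complex))"
proof (rule summable_norm_ratio_limit)
  show "norm (of_real (gauss (int (Suc n)) / poch (Suc n)) * b ^ Suc n :: complex) =
     (p ^ n * norm b / (1 - p ^ Suc n)) * norm (of_real (gauss (int n) / poch n) * b ^ n :: complex)" for n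
  proof -
    have "gauss (int (Suc n)) / poch (Suc n) = p ^ n / (1 - p ^ Suc n) * (gauss (int n) / poch n)"
      using gauss_Suc[of "int n"] by (simp add: poch_Suc add.commute mult.commute)
    moreover have "0 \<le> gauss (int k) / poch k" for k
      by (intro divide_nonneg_nonneg less_imp_le gauss_pos poch_pos)
    ultimately show ?thesis
      unfolding norm_of_real_mult_power[OF \<open>0 \<le> gauss (int (Suc n)) / poch (Suc n)\<close>]
        norm_of_real_mult_power[OF \<open>0 \<le> gauss (int n) / poch n\<close>] by simp
  qed
  have "(\<lambda>n. p ^ n * norm b / (1 - p ^ Suc n)) \<longlonglongrightarrow> 0 * norm b / (1 - 0)"
    using p_power_tendsto by (intro tendsto_intros LIMSEQ_power_zero) (use p_pos p_less_1 in auto)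
  then show "(\<lambda>n. p ^ n * norm b / (1 - p ^ Suc n)) \<longlonglongrightarrow> 0" by simp
qed simp

lemma summable_norm_eul_inv:
  assumes "norm z < 1"
  shows "summable (\<lambda>n. norm (of_real (1 / poch n) * z ^ n :: complex))"
proof (rule summable_norm_ratio_limit)
  show "norm (of_real (1 / poch (Suc n)) * z ^ Suc n :: complex) =
     (norm z / (1 - p ^ Suc n)) * norm (of_real (1 / poch n) * z ^ n :: complex)" for n
    by (subst (1 2) norm_of_real_mult_power)
      (simp_all add: less_imp_le[OF poch_pos], simp add: poch_Suc mult.commute)
  have "(\<lambda>n. norm z / (1 - p ^ Suc n)) \<longlonglongrightarrow> norm z / (1 - 0)"
    using p_power_tendsto by (intro tendsto_intros) auto
  then show "(\<lambda>n. norm z / (1 - p ^ Suc n)) \<longlonglongrightarrow> norm z" by simp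
qed (use assms in simp)

lemma eul_sums: "(\<lambda>n. of_real (gauss (int n) / poch n) * b ^ n) sums eul b"
  unfolding eul_def by (rule summable_sums[OF summable_norm_cancel[OF summable_norm_eul]])

lemma eul_inv_sums: "norm z < 1 \<Longrightarrow> (\<lambda>n. of_real (1 / poch n) * z ^ n) sums eul_inv z"
  unfolding eul_inv_def by (rule summable_sums[OF summable_norm_cancel[OF summable_norm_eul_inv]])

lemma eul_has_sum: "((\<lambda>n. of_real (gauss (int n) / poch n) * b ^ n) has_sum eul b) UNIV"
  by (rule norm_summable_imp_has_sum[OF summable_norm_eul eul_sums])

lemma eul_inv_has_sum: "norm z < 1 \<Longrightarrow> ((\<lambda>n. of_real (1 / poch n) * z ^ n) has_sum eul_inv z) UNIV"
  by (rule norm_summable_imp_has_sum[OF summable_norm_eul_inv eul_inv_sums])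

lemma isCont_eul: "isCont eul b"
  unfolding eul_def[abs_def]
  by (rule isCont_powser_converges_everywhere) (rule summable_norm_cancel[OF summable_norm_eul])

lemma isCont_eul_inv: "norm z < 1 \<Longrightarrow> isCont eul_inv z"
proof -
  assume "norm z < 1"
  then obtain r where r: "norm z < r" "r < 1" using dense by blast
  show ?thesis
    unfolding eul_inv_def[abs_def]
  proof (rule isCont_powser)
    show "summable (\<lambda>n. of_real (1 / poch n) * (of_real r :: complex) ^ n)"
      by (rule summable_norm_cancel[OF summable_norm_eul_inv]) (use r norm_ge_zero[of z] in \<open>simp del: norm_ge_zero\<close>)
    show "norm z < norm (of_real r :: complex)" using r by simp
  qed
qed

lemma eul_0 [simp]: "eul 0 = 1"
  using sums_unique2[OF eul_sums[of 0] powser_sums_zero] by simp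

lemma eul_inv_0 [simp]: "eul_inv 0 = 1"
  using sums_unique2[OF eul_inv_sums[of 0] powser_sums_zero] by simp

text \<open>Splits off the first factor of the infinite product. In the difference of the two series
  the n-th coefficient gains the factor \<open>1 - p^n\<close>, which cancels the last factor of
  \<open>poch n\<close>.\<close>

lemma eul_rec: "eul b = (1 + b) * eul (of_real p * b)"
proof -
  let ?c = "\<lambda>n. of_real (gauss (int n) / poch n) :: complex"
  have "(\<lambda>n. ?c n * b ^ n - ?c n * (of_real p * b) ^ n) sums (eul b - eul (of_real p * b))"
    by (intro sums_diff eul_sums)
  \<comment> \<open>The constant terms cancel, so the sum may start at index 1.\<close>
  then have *: "(\<lambda>n. ?c (Suc n) * b ^ Suc n - ?c (Suc n) * (of_real p * b) ^ Suc n) sums (eul b - eul (of_real p * b))"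
    by (subst sums_Suc_iff) simp
  have "?c (Suc n) * b ^ Suc n - ?c (Suc n) * (of_real p * b) ^ Suc n = b * (?c n * (of_real p * b) ^ n)" for n
  proof -
    have "gauss (int (Suc n)) / poch (Suc n) * (1 - p ^ Suc n) = gauss (int n) / poch n * p ^ n"
      using gauss_Suc[of "int n"] p_power_less_1[of "Suc n"]
      by (simp add: poch_Suc field_simps)
    then have "?c (Suc n) * of_real (1 - p ^ Suc n) = ?c n * of_real (p ^ n)"
      by (metis of_real_mult)
    then show ?thesis
      unfolding diff_scaled_power by (simp add: power_mult_distrib)
  qed
  with * have "(\<lambda>n. b * (?c n * (of_real p * b) ^ n)) sums (eul b - eul (of_real p * b))"
    by simp
  moreover have "(\<lambda>n. b * (?c n * (of_real p * b) ^ n)) sums (b * eul (of_real p * b))"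
    by (intro sums_mult eul_sums)
  ultimately have "eul b - eul (of_real p * b) = b * eul (of_real p * b)"
    by (rule sums_unique2)
  then show ?thesis by (simp add: algebra_simps)
qed

lemma norm_p_mult_less: "norm z < 1 \<Longrightarrow> norm (of_real p * z :: complex) < 1"
  using p_pos p_less_1 by (simp add: norm_mult) (metis less_trans mult_less_cancel_right1 mult_zero_right norm_ge_zero not_less_iff_gr_or_eq order_le_less zero_less_one)

lemma eul_inv_rec:
  assumes "norm z < 1"
  shows "eul_inv (of_real p * z) = (1 - z) * eul_inv z"
proof -
  let ?c = "\<lambda>n. of_real (1 / poch n) :: complex"
  have "(\<lambda>n. ?c n * z ^ n - ?c n * (of_real p * z) ^ n) sums (eul_inv z - eul_inv (of_real p * z))"
    by (intro sums_diff eul_inv_sums norm_p_mult_less assms)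
  then have *: "(\<lambda>n. ?c (Suc n) * z ^ Suc n - ?c (Suc n) * (of_real p * z) ^ Suc n) sums (eul_inv z - eul_inv (of_real p * z))"
    by (subst sums_Suc_iff) simp
  have "?c (Suc n) * z ^ Suc n - ?c (Suc n) * (of_real p * z) ^ Suc n = z * (?c n * z ^ n)" for n
  proof -
    have "1 / poch (Suc n) * (1 - p ^ Suc n) = 1 / poch n"
      using p_power_less_1[of "Suc n"] by (simp add: poch_Suc field_simps)
    then have "?c (Suc n) * of_real (1 - p ^ Suc n) = ?c n"
      by (metis of_real_mult)
    then show ?thesis
      unfolding diff_scaled_power by simp
  qed
  with * have "(\<lambda>n. z * (?c n * z ^ n)) sums (eul_inv z - eul_inv (of_real p * z))"
    by simp
  moreover have "(\<lambda>n. z * (?c n * z ^ n)) sums (z * eul_inv z)"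
    by (intro sums_mult eul_inv_sums assms)
  ultimately have "eul_inv z - eul_inv (of_real p * z) = z * eul_inv z"
    by (rule sums_unique2)
  then show ?thesis by (simp add: algebra_simps)
qed

text \<open>The factors \<open>1 - z\<close> from the two recursions cancel, so the product is
  invariant under \<open>z\<close> to \<open>p z\<close> and equals its value at 0.\<close>

lemma eul_inv_mult_eul:
  assumes "norm z < 1"
  shows "eul_inv z * eul (- z) = 1"
proof -
  define h where "h = (\<lambda>z. eul_inv z * eul (- z))"
  have rec: "h (of_real p * z) = h z" if "norm z < 1" for z
    using eul_inv_rec[OF that] eul_rec[of "- z"] by (simp add: h_def)
  have "norm (of_real p ^ n * z) < 1 \<and> h (of_real p ^ n * z) = h z" for n
  proof (induction n)
    case (Suc n)
    then show ?case
      using rec[of "of_real p ^ n * z"] norm_p_mult_less[of "of_real p ^ n * z"]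
      by (simp add: mult.assoc)
  qed (use assms in simp)
  moreover have "isCont (\<lambda>z. eul (- z)) 0"
    by (rule isCont_o2[OF _ isCont_eul]) (intro continuous_intros)
  then have "isCont h 0"
    unfolding h_def by (intro continuous_intros isCont_eul_inv) simp_all
  ultimately have "h 0 = h z"
    using tendsto_unique_scaling[of h p z "h z"] p_pos p_less_1 by blast
  then show ?thesis by (simp add: h_def)
qed

lemma eul_minus_1 [simp]: "eul (- 1) = 0"
  using eul_rec[of "- 1"] by simp

text \<open>If no factor \<open>1 + p^n b\<close> vanished, \<open>eul_rec\<close> would carry the
  zero to every \<open>p^n b\<close>, and in the limit to 0, where \<open>eul\<close> is 1.\<close>

lemma eul_zeroD:
  assumes "eul b = 0"
  shows "\<exists>n. of_real (p ^ n) * b = - 1"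
proof (rule ccontr)
  assume *: "\<nexists>n. of_real (p ^ n) * b = - 1"
  have "eul (of_real p ^ n * b) = 0" for n
  proof (induction n)
    case (Suc n)
    have "1 + of_real p ^ n * b \<noteq> 0"
      using * by (metis add_diff_cancel_left' of_real_power diff_0)
    then show ?case
      using Suc eul_rec[of "of_real p ^ n * b"] by (simp add: mult.assoc)
  qed (use assms in simp)
  then have "eul 0 = 0"
    using tendsto_unique_scaling[of eul p b 0] p_pos p_less_1 isCont_eul by blast
  then show False by simp
qed

text \<open>This is the splitting of \<open>(p;p)_inf\<close> into its first \<open>n\<close>
  factors and the tail, which is \<open>eul\<close> at \<open>-p^(n+1)\<close>.\<close>

lemma eul_neg_power: "eul (- of_real (p ^ Suc n)) * of_real (poch n) = poch_inf"
proof (induction n)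
  case (Suc n)
  have "eul (- of_real (p ^ Suc n)) = of_real (1 - p ^ Suc n) * eul (- of_real (p ^ Suc (Suc n)))"
    using eul_rec[of "- of_real (p ^ Suc n)"] by simp
  with Suc show ?case by (simp add: poch_Suc mult_ac)
qed (simp add: poch_inf_def)

text \<open>The product for \<open>eul\<close> at this point contains the factor
  \<open>1 - 1\<close>. This cuts the bilateral series in \<open>theta_mult_eul_inv\<close> down to
  nonnegative powers.\<close>

lemma eul_neg_power_int_eq_0: 
  assumes "m \<le> 0"
  shows "eul (- of_real (p powi m)) = 0"
proof -
  have "eul (- of_real (p powi (- int k))) = 0" for k
  proof (induction k)
    case (Suc k)
    have "p * p powi (- int (Suc k)) = p powi (- int k)"
      using power_int_add[of p 1 "- int (Suc k)"] by simp
    then have "of_real p * - of_real (p powi (- int (Suc k))) = - (of_real (p powi (- int k)) :: complex)"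
      by (metis mult_minus_right of_real_mult)
    then show ?case
      using Suc eul_rec[of "- of_real (p powi (- int (Suc k)))"] by simp
  qed simp
  from this[of "nat (- m)"] assms show ?thesis by simp
qed

lemma poch_inf_nz [simp]: "poch_inf \<noteq> 0"
  using eul_inv_mult_eul[of "of_real p"] p_pos p_less_1 unfolding poch_inf_def
  by (metis mult_zero_right norm_of_real abs_of_pos zero_neq_one)

text \<open>Through the series of \<open>eul_inv\<close>, every coefficient \<open>(p;p)_n\<close>
  becomes a sum of powers of \<open>p^(n+1)\<close>, as required for expanding
  \<open>phi\<close>.\<close>

lemma poch_eq_eul_inv: "of_real (poch n) = poch_inf * eul_inv (of_real (p ^ Suc n))"
proof -
  have "eul_inv (of_real (p ^ Suc n)) * eul (- of_real (p ^ Suc n)) = 1"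
    by (rule eul_inv_mult_eul) (simp only: norm_of_real, use p_pos p_power_less_1[of "Suc n"] in simp)
  then show ?thesis
    using eul_neg_power[of n] by (metis mult.commute mult.left_commute mult.right_neutral)
qed

end

subsection \<open>The theta function\<close>

text \<open>Summable complex families are absolutely summable, so the product family is absolutely
  summable and may be summed row by row.\<close>

lemma has_sum_product:
  fixes f :: "'a \<Rightarrow> complex" and g :: "'b \<Rightarrow> complex"
  assumes "(f has_sum F) UNIV" and "(g has_sum G) UNIV"
  shows "((\<lambda>(x, y). f x * g y) has_sum F * G) UNIV"
proof -
  have f: "(\<lambda>x. norm (f x)) summable_on UNIV" and g: "(\<lambda>y. norm (g y)) summable_on UNIV"
    using assms[THEN has_sum_imp_summable] by (simp_all add: summable_on_iff_abs_summable_on_complex)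
  have "(\<lambda>(x, y). norm (f x) * norm (g y)) summable_on UNIV \<times> UNIV"
  proof (rule summable_on_SigmaI)
    show "((\<lambda>y. case (x, y) of (x, y) \<Rightarrow> norm (f x) * norm (g y)) has_sum norm (f x) * infsum (\<lambda>y. norm (g y)) UNIV) UNIV" for x
      using has_sum_cmult_right[OF has_sum_infsum[OF g]] by simp
    show "(\<lambda>x. norm (f x) * infsum (\<lambda>y. norm (g y)) UNIV) summable_on UNIV"
      by (rule summable_on_cmult_left[OF f])
  qed simp
  then have "(\<lambda>(x, y). f x * g y) summable_on UNIV \<times> UNIV"
    using abs_summable_summable[of "\<lambda>(x, y). f x * g y"]
    by (simp add: case_prod_unfold norm_mult)
  then have "((\<lambda>(x, y). f x * g y) has_sum F * G) (UNIV \<times> UNIV)"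
    by (intro has_sum_SigmaI[where g = "\<lambda>x. f x * G"])
      (auto intro: has_sum_cmult_right has_sum_cmult_left assms)
  then show ?thesis by simp
qed

lemma summable_on_int:
  fixes f :: "int \<Rightarrow> real"
  assumes "(\<lambda>n. f (int n)) summable_on UNIV" and "(\<lambda>n. f (- int n)) summable_on UNIV"
  shows "f summable_on UNIV"
proof -
  have "f summable_on range int" "f summable_on range (\<lambda>n. - int n)"
    using assms by (subst summable_on_reindex; simp add: o_def inj_on_def)+
  then have "f summable_on (range int \<union> range (\<lambda>n. - int n))"
    by (rule summable_on_union)
  also have "range int \<union> range (\<lambda>n. - int n) = UNIV"
    by (auto simp: image_def) (metis int_cases2)
  finally show ?thesis .
qed

context q_base
begin

section \<open>Convergence and quasi-periodicity of theta\<close>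

lemma theta_def': "theta p b = (\<Sum>\<^sub>\<infinity>n. of_real (gauss n) * b powi n)"
  by (simp add: theta_def gauss_def)

lemma summable_norm_half_theta: "summable (\<lambda>n. norm (of_real (gauss (int n)) * b ^ n :: complex))"
proof (rule summable_norm_ratio_limit)
  show "norm (of_real (gauss (int (Suc n))) * b ^ Suc n :: complex) =
     (p ^ n * norm b) * norm (of_real (gauss (int n)) * b ^ n :: complex)" for n
    using gauss_Suc[of "int n"]
    by (subst (1 2) norm_of_real_mult_power)
      (simp_all only: less_imp_le[OF gauss_pos], simp add: add.commute)
  have "(\<lambda>n. p ^ n * norm b) \<longlonglongrightarrow> 0 * norm b"
    by (intro tendsto_intros LIMSEQ_power_zero) (use p_pos p_less_1 in auto)
  then show "(\<lambda>n. p ^ n * norm b) \<longlonglongrightarrow> 0" by simp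
qed simp

lemma theta_term_minus:
  "of_real (gauss (- int n)) * b powi (- int n) = of_real (gauss (int n)) * (of_real p / b :: complex) ^ n"
  by (simp add: gauss_minus power_int_minus field_simps)

lemma theta_abs_summable: "(\<lambda>n. norm (of_real (gauss n) * b powi n :: complex)) summable_on UNIV"
proof (rule summable_on_int)
  show "(\<lambda>n. norm (of_real (gauss (int n)) * b powi int n)) summable_on UNIV"
    using summable_norm_half_theta[of b] by (intro summable_nonneg_imp_summable_on) simp_all
  show "(\<lambda>n. norm (of_real (gauss (- int n)) * b powi (- int n))) summable_on UNIV"
    unfolding theta_term_minus
    using summable_norm_half_theta[of "of_real p / b"] by (intro summable_nonneg_imp_summable_on) simp_all
qed

lemma theta_has_sum: "((\<lambda>n. of_real (gauss n) * b powi n) has_sum theta p b) UNIV"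
  unfolding theta_def' by (rule has_sum_infsum[OF abs_summable_summable[OF theta_abs_summable]])

text \<open>Shift the summation index by \<open>m\<close> and factor the weight with
  \<open>gauss_add\<close>.\<close>

lemma theta_scale:
  assumes "b \<noteq> 0"
  shows "theta p b = of_real (gauss m) * b powi m * theta p (of_real (p powi m) * b)"
proof -
  have "((\<lambda>n. of_real (gauss m) * b powi m * (of_real (gauss n) * (of_real (p powi m) * b) powi n))
          has_sum of_real (gauss m) * b powi m * theta p (of_real (p powi m) * b)) UNIV"
    by (intro has_sum_cmult_right theta_has_sum)
  also have "(\<lambda>n. of_real (gauss m) * b powi m * (of_real (gauss n) * (of_real (p powi m) * b) powi n)) =
        (\<lambda>n. of_real (gauss (m + n)) * b powi (m + n))"
    using assms by (intro ext) (simp add: gauss_add power_int_add power_int_mult_distrib mult_ac flip: power_int_mult)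
  also have "(\<dots> has_sum of_real (gauss m) * b powi m * theta p (of_real (p powi m) * b)) UNIV \<longleftrightarrow>
     ((\<lambda>n. of_real (gauss n) * b powi n) has_sum of_real (gauss m) * b powi m * theta p (of_real (p powi m) * b)) UNIV"
    by (rule has_sum_reindex_bij_witness[of _ "\<lambda>n. n - m" "\<lambda>n. m + n"]) auto
  finally show ?thesis
    using has_sum_unique[OF theta_has_sum] by blast
qed

text \<open>
  Expand \<open>theta p b * eul_inv (- p / b)\<close> as a double series and collect powers of \<open>b\<close>: the
  coefficient of \<open>b\<^sup>n\<close> is \<open>gauss n * eul (- p\<^sup>n\<^sup>+\<^sup>1)\<close>, which vanishes for negative \<open>n\<close>.
\<close>

lemma theta_mult_eul_inv:
  assumes "p < norm b"
  shows "theta p b * eul_inv (- of_real p / b) = poch_inf * eul b"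
proof -
  have b: "b \<noteq> 0" using assms p_pos by auto
  let ?z = "- of_real p / b"
  let ?S = "theta p b * eul_inv ?z"
  let ?f = "\<lambda>(n, k). (of_real (gauss n) * b powi n) * (of_real (1 / poch k) * ?z ^ k)"
  \<comment> \<open>After the shift by \<open>k\<close> the total power of \<open>b\<close> is
    \<open>n\<close>. The weight of \<open>n + k\<close> splits by \<open>gauss_add\<close>:
    \<open>gauss k\<close> completes the coefficient of \<open>eul\<close>, and
    \<open>p^(n k)\<close> goes into its argument.\<close>
  have key: "?f (n + int k, k) = (of_real (gauss n) * b powi n) *
      (of_real (gauss (int k) / poch k) * (- of_real (p powi (n + 1))) ^ k)" for n k
  proof -
    have 1: "b powi (n + int k) * ?z ^ k = b powi n * (- of_real p) ^ k"
      using b by (simp add: power_int_add mult.assoc flip: power_mult_distrib)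
    have 2: "(- of_real (p powi (n + 1)) :: complex) ^ k = of_real (p powi (n * int k)) * (- of_real p) ^ k"
    proof -
      have "- of_real (p powi (n + 1)) = (of_real (p powi n) * (- of_real p) :: complex)"
        by (simp add: power_int_add)
      then show ?thesis
        by (simp only: power_mult_distrib) (simp add: power_int_mult)
    qed
    have 3: "gauss (n + int k) * (1 / poch k) = gauss n * (gauss (int k) / poch k) * p powi (n * int k)"
      by (simp add: gauss_add)
    have "?f (n + int k, k) = of_real (gauss (n + int k) * (1 / poch k)) * (b powi (n + int k) * ?z ^ k)"
      by simp
    also have "\<dots> = (of_real (gauss n) * b powi n) *
      (of_real (gauss (int k) / poch k) * (- of_real (p powi (n + 1))) ^ k)"
      unfolding 1 2 3 by simp
    finally show ?thesis .
  qed
  have "norm ?z < 1"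
    using assms b p_pos by (simp add: norm_divide)
  then have "(?f has_sum ?S) UNIV"
    by (intro has_sum_product theta_has_sum eul_inv_has_sum)
  also have "(?f has_sum ?S) UNIV \<longleftrightarrow> ((\<lambda>(n, k). ?f (n + int k, k)) has_sum ?S) UNIV"
    by (rule has_sum_reindex_bij_witness[of _ "\<lambda>(n, k). (n + int k, k)" "\<lambda>(n, k). (n - int k, k)"]) auto
  also have "(\<lambda>(n, k). ?f (n + int k, k)) = (\<lambda>(n, k). (of_real (gauss n) * b powi n) *
      (of_real (gauss (int k) / poch k) * (- of_real (p powi (n + 1))) ^ k))"
    by (simp only: key)
  finally have "((\<lambda>(n, k). (of_real (gauss n) * b powi n) *
      (of_real (gauss (int k) / poch k) * (- of_real (p powi (n + 1))) ^ k)) has_sum ?S) (UNIV \<times> UNIV)"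
    by simp
  then have "((\<lambda>n. (of_real (gauss n) * b powi n) * eul (- of_real (p powi (n + 1)))) has_sum ?S) UNIV"
    by (rule has_sum_SigmaD) (simp only: case_prod_conv, rule has_sum_cmult_right[OF eul_has_sum])
  also have "?this \<longleftrightarrow> ((\<lambda>n. (of_real (gauss n) * b powi n) * eul (- of_real (p powi (n + 1)))) has_sum ?S) (range int)"
  proof (rule has_sum_cong_neutral)
    fix n :: int assume "n \<in> UNIV - range int"
    then have "n < 0"
      by (metis DiffE not_less rangeI zero_le_imp_eq_int)
    then have "eul (- of_real (p powi (n + 1))) = 0"
      by (intro eul_neg_power_int_eq_0) simp
    then show "of_real (gauss n) * b powi n * eul (- of_real (p powi (n + 1))) = 0"
      by simp
  qed auto
  also have "\<dots> \<longleftrightarrow> ((\<lambda>n. poch_inf * (of_real (gauss (int n) / poch n) * b ^ n)) has_sum ?S) UNIV"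
  proof (subst has_sum_reindex)
    have "of_real (gauss (int n)) * b powi int n * eul (- of_real (p powi (int n + 1))) =
        poch_inf * (of_real (gauss (int n) / poch n) * b ^ n)" for n
    proof -
      have "p powi (int n + 1) = p ^ Suc n"
        by (simp add: power_int_add)
      then show ?thesis
        by (simp flip: eul_neg_power[of n])
    qed
    then show "(((\<lambda>n. of_real (gauss n) * b powi n * eul (- of_real (p powi (n + 1)))) \<circ> int) has_sum ?S) UNIV =
       ((\<lambda>n. poch_inf * (of_real (gauss (int n) / poch n) * b ^ n)) has_sum ?S) UNIV"
      by (simp add: o_def)
  qed simp
  finally show ?thesis
    using has_sum_unique[OF has_sum_cmult_right[OF eul_has_sum]] by metis
qed

text \<open>For norms above \<open>p\<close>, multiplying \<open>theta_mult_eul_inv\<close> by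
  \<open>eul (p / b)\<close> removes \<open>eul_inv\<close>. Both sides obey the same functional
  equation under \<open>b\<close> to \<open>p b\<close>, which spreads the identity inward to all
  nonzero \<open>b\<close>.\<close>

lemma jacobi_triple_product:
  assumes "b \<noteq> 0"
  shows "theta p b = poch_inf * eul b * eul (of_real p / b)"
proof -
  have large: "theta p b = poch_inf * eul b * eul (of_real p / b)" if "p < norm b" for b
  proof -
    have "norm (- of_real p / b) < 1"
      using that p_pos by (auto simp: norm_divide divide_less_eq)
    from eul_inv_mult_eul[OF this] show ?thesis
      using theta_mult_eul_inv[OF that] by (simp add: mult.assoc flip: theta_mult_eul_inv[OF that])
  qed
  have "theta p b = poch_inf * eul b * eul (of_real p / b)" if "b \<noteq> 0" "p ^ Suc n < norm b" for n b
    using that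
  proof (induction n arbitrary: b)
    case 0
    then show ?case by (intro large) simp
  next
    case (Suc n)
    \<comment> \<open>The induction hypothesis holds at the point \<open>c\<close>, one step further
      out.\<close>
    define c where "c = b / of_real p"
    have b: "b = of_real p * c" and c: "c \<noteq> 0"
      using Suc.prems(1) by (simp_all add: c_def)
    have "p ^ Suc n < norm c"
      using Suc.prems(2) p_pos by (simp add: b norm_mult mult.left_commute)
    then have IH: "theta p c = poch_inf * eul c * eul (of_real p / c)"
      by (rule Suc.IH[OF c])
    have "theta p c = c * theta p b"
      using theta_scale[OF c, of 1] by (simp add: b)
    moreover have "eul c = (1 + c) * eul b"
      unfolding b by (rule eul_rec)
    ultimately have "c * theta p b = poch_inf * eul b * ((1 + c) * eul (of_real p / c))"
      using IH by (simp add: mult_ac)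
    \<comment> \<open>Since \<open>p / b = 1 / c\<close>, this is \<open>eul_rec\<close> at
      \<open>1 / c\<close> multiplied by \<open>c\<close>.\<close>
    also have "(1 + c) * eul (of_real p / c) = c * eul (of_real p / b)"
      using eul_rec[of "1 / c"] c by (simp add: b field_simps)
    finally show ?case using c by simp
  qed
  moreover have "\<exists>n. p ^ Suc n < norm b"
    using order_tendstoD(2)[OF p_power_tendsto, of "norm b"] assms
    by (auto simp: eventually_sequentially)
  ultimately show ?thesis using assms by blast
qed

text \<open>In the triple product, \<open>eul b\<close> vanishes only at points
  \<open>-p^(-n)\<close> and \<open>eul (p / b)\<close> only at points \<open>-p^(n+1)\<close>;
  together these make up all \<open>-p^m\<close> with integer \<open>m\<close>.\<close>

lemma theta_nz:
  assumes "b \<noteq> 0" and "\<And>m. of_real (p powi m) * b \<noteq> - 1"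
  shows "theta p b \<noteq> 0"
proof -
  have "eul b \<noteq> 0"
    using eul_zeroD[of b] assms(2)[of "int n" for n] by auto
  moreover have "eul (of_real p / b) \<noteq> 0"
  proof
    assume "eul (of_real p / b) = 0"
    then obtain n where "of_real (p ^ n) * (of_real p / b) = - 1"
      using eul_zeroD by blast
    then have "b = - of_real (p ^ Suc n)"
      using assms(1) by (simp add: nonzero_divide_eq_eq mult.commute)
    then have "of_real (p powi (- int (Suc n))) * b = - 1"
      by (simp add: power_int_minus del: power_Suc of_nat_Suc)
    then show False using assms(2) by blast
  qed
  ultimately show ?thesis
    using jacobi_triple_product[OF assms(1)] by simp
qed

text \<open>By \<open>theta_scale\<close>, \<open>1 / theta(p^(-m) b)\<close> is
  \<open>gauss m * (p / b)^m / theta(b)\<close>. The weights \<open>1 / poch m\<close> sum this to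
  \<open>eul (p / b) / theta(b)\<close>, and the triple product leaves the reciprocal of
  \<open>poch_inf * eul b\<close>.\<close>

lemma sum_inverse_theta:
  assumes "b \<noteq> 0" and "theta p b \<noteq> 0"
  shows "((\<lambda>m. of_real (1 / poch m) / theta p (of_real (p powi (- int m)) * b)) has_sum
            1 / (poch_inf * eul b)) UNIV"
proof -
  have "((\<lambda>m. 1 / theta p b * (of_real (gauss (int m) / poch m) * (of_real p / b) ^ m)) has_sum
      1 / theta p b * eul (of_real p / b)) UNIV"
    by (intro has_sum_cmult_right eul_has_sum)
  also have "1 / theta p b * eul (of_real p / b) = 1 / (poch_inf * eul b)"
    using assms by (simp add: jacobi_triple_product)
  also have "(\<lambda>m. 1 / theta p b * (of_real (gauss (int m) / poch m) * (of_real p / b) ^ m)) =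
      (\<lambda>m. of_real (1 / poch m) / theta p (of_real (p powi (- int m)) * b))"
  proof
    fix m
    have "theta p b = of_real (gauss (int m)) * (of_real p / b) ^ m * theta p (of_real (p powi (- int m)) * b)"
      using theta_scale[OF assms(1), of "- int m"] unfolding theta_term_minus .
    moreover have "1 / u * (of_real (g / c) * y) = of_real (1 / c) / t" if "u = of_real g * y * t" "u \<noteq> 0"
      for u y t :: complex and g c
      using that by simp
    ultimately show "1 / theta p b * (of_real (gauss (int m) / poch m) * (of_real p / b) ^ m) =
        of_real (1 / poch m) / theta p (of_real (p powi (- int m)) * b)"
      using assms(2) by blast
  qed
  finally show ?thesis .
qed

lemma continuous_on_eul [continuous_intros]:
  "continuous_on A f \<Longrightarrow> continuous_on A (\<lambda>x. eul (f x))"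
  by (rule continuous_on_compose2[of UNIV eul])
    (auto intro: continuous_at_imp_continuous_on isCont_eul)

lemma continuous_on_theta: "continuous_on (- {0}) (theta p)"
proof -
  have "continuous_on (- {0}) (\<lambda>b. poch_inf * eul b * eul (of_real p / b))"
    by (intro continuous_intros) auto
  then show ?thesis
    by (rule continuous_on_eq) (simp add: jacobi_triple_product)
qed


subsection \<open>Analytic continuation of the series \<open>\<phi>\<close>\<close>

text \<open>After multiplication by \<open>poch_inf\<close> and rescaling of the argument by
  \<open>1 - p\<close> this is \<open>phi\<close>, see \<open>phi_eq\<close>.\<close>

definition psi_series :: "complex \<Rightarrow> complex" where
  "psi_series z = (\<Sum>m. of_real (p ^ m / poch m) * psi (of_real (p ^ m) * z))"

definition psi_regular :: "complex set" where
  "psi_regular = {z. \<forall>m. 1 + of_real (p ^ m) * z \<noteq> 0}"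

text \<open>Near \<open>z\<close>, only finitely many \<open>m\<close> can bring
  \<open>1 + p^m u\<close> close to 0; for all later \<open>m\<close> the number
  \<open>p^m u\<close> has norm at most 1/2. Hence one radius and one bound serve every
  \<open>m\<close>, as the M-test requires.\<close>

lemma psi_locally_bounded:
  assumes "z \<in> psi_regular"
  obtains r C where "0 < r" "cball z r \<subseteq> psi_regular"
    "\<And>m u. u \<in> cball z r \<Longrightarrow> norm (psi (of_real (p ^ m) * u)) \<le> C"
proof -
  have "(\<lambda>m. p ^ m * (norm z + 1)) \<longlonglongrightarrow> 0 * (norm z + 1)"
    by (intro tendsto_intros LIMSEQ_power_zero) (use p_pos p_less_1 in auto)
  then have "eventually (\<lambda>m. p ^ m * (norm z + 1) < 1 / 2) sequentially"
    by (rule order_tendstoD) simp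
  then obtain M where M: "\<And>m. m \<ge> M \<Longrightarrow> p ^ m * (norm z + 1) < 1 / 2"
    by (auto simp: eventually_sequentially)
  \<comment> \<open>The inserted 1 covers the case \<open>M = 0\<close> and keeps the radius
    \<open>d / 2\<close> below 1, so that \<open>u\<close> has norm at most
    \<open>norm z + 1\<close>.\<close>
  define d where "d = Min (insert 1 ((\<lambda>m. norm (1 + of_real (p ^ m) * z)) ` {..<M}))"
  have d_pos: "0 < d" and d_le: "d \<le> 1" "\<And>m. m < M \<Longrightarrow> d \<le> norm (1 + of_real (p ^ m) * z)"
    using assms by (auto simp: d_def psi_regular_def)
  have lower: "d / 2 \<le> norm (1 + of_real (p ^ m) * u)" if u: "u \<in> cball z (d / 2)" for m u
  proof (cases "m < M")
    case True
    have "norm (of_real (p ^ m) * (z - u)) \<le> 1 * (d / 2)"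
      unfolding norm_mult using u p_pos p_less_1
      by (intro mult_mono) (auto simp: dist_norm norm_power power_le_one)
    moreover have "norm (1 + of_real (p ^ m) * z) \<le> norm (1 + of_real (p ^ m) * u) + norm (of_real (p ^ m) * (z - u))"
      by (rule order_trans[OF eq_refl norm_triangle_ineq]) (simp add: algebra_simps)
    ultimately show ?thesis
      using d_le(2)[OF True] by simp
  next
    case False
    have "norm u \<le> norm z + norm (u - z)"
      using norm_triangle_ineq[of z "u - z"] by simp
    also have "\<dots> \<le> norm z + 1"
      using u d_le(1) by (simp add: dist_norm norm_minus_commute)
    finally have "norm (of_real (p ^ m) * u) \<le> p ^ m * (norm z + 1)"
      unfolding norm_mult using p_pos by (intro mult_mono) (auto simp: norm_power)
    with M[of m] False have "norm (of_real (p ^ m) * u) \<le> 1 / 2"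
      by simp
    moreover have "norm (1 :: complex) \<le> norm (1 + of_real (p ^ m) * u) + norm (of_real (p ^ m) * u)"
      using norm_triangle_ineq4[of "1 + of_real (p ^ m) * u" "of_real (p ^ m) * u"] by simp
    ultimately show ?thesis
      using d_le(1) by simp
  qed
  show ?thesis
  proof (rule that)
    show "0 < d / 2" using d_pos by simp
    show "cball z (d / 2) \<subseteq> psi_regular"
    proof
      fix u assume u: "u \<in> cball z (d / 2)"
      have "1 + of_real (p ^ m) * u \<noteq> 0" for m
        using lower[OF u, of m] d_pos by auto
      then show "u \<in> psi_regular"
        by (simp add: psi_regular_def)
    qed
    show "norm (psi (of_real (p ^ m) * u)) \<le> 1 / (d / 2)" if "u \<in> cball z (d / 2)" for m u
      using lower[OF that, of m] d_pos unfolding psi_def norm_divide norm_one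
      by (intro divide_left_mono mult_pos_pos) auto
  qed
qed

lemma open_psi_regular: "open psi_regular"
  unfolding open_contains_cball by (metis psi_locally_bounded)

lemma summable_weights: "summable (\<lambda>m. p ^ m / poch m)"
  using summable_norm_eul_inv[of "of_real p"] p_pos p_less_1
  by (simp add: norm_mult norm_divide norm_power less_imp_le[OF poch_pos])

lemma holomorphic_psi_series: "psi_series holomorphic_on psi_regular"
proof (rule holomorphic_uniform_sequence[OF open_psi_regular])
  let ?f = "\<lambda>m z. of_real (p ^ m / poch m) * psi (of_real (p ^ m) * z)"
  show "(\<lambda>z. \<Sum>m<n. ?f m z) holomorphic_on psi_regular" for n
    unfolding psi_def by (intro holomorphic_intros) (auto simp: psi_regular_def)
  fix z assume "z \<in> psi_regular"
  from psi_locally_bounded[OF this] obtain r C where r: "0 < r" "cball z r \<subseteq> psi_regular"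
    and C: "\<And>m u. u \<in> cball z r \<Longrightarrow> norm (psi (of_real (p ^ m) * u)) \<le> C"
    by blast
  have "uniform_limit (cball z r) (\<lambda>n u. \<Sum>m<n. ?f m u) psi_series sequentially"
    unfolding psi_series_def[abs_def]
  proof (rule Weierstrass_m_test)
    show "norm (?f m u) \<le> p ^ m / poch m * C" if "u \<in> cball z r" for m u
      unfolding norm_mult norm_of_real using C[OF that] p_pos poch_pos[of m]
      by (intro mult_mono) auto
    show "summable (\<lambda>m. p ^ m / poch m * C)"
      by (intro summable_mult2 summable_weights)
  qed
  with r show "\<exists>d>0. cball z d \<subseteq> psi_regular \<and>
      uniform_limit (cball z d) (\<lambda>n u. \<Sum>m<n. ?f m u) psi_series sequentially"
    by blast
qed

lemma norm_p_power_mult_le: "norm (of_real (p ^ m) * z :: complex) \<le> norm z"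
  using p_pos p_less_1 by (simp add: norm_mult norm_power mult_left_le_one_le power_le_one)

text \<open>Expand each \<open>psi\<close> as a geometric series and exchange the two sums. The
  coefficient of \<open>(-z)^n\<close> is then \<open>eul_inv (p^(n+1))\<close>, which
  \<open>poch_eq_eul_inv\<close> identifies with \<open>poch n / poch_inf\<close>.\<close>

lemma psi_series_power_series:
  assumes "norm z < 1"
  shows "(\<lambda>n. of_real (poch n) * (- z) ^ n) sums (poch_inf * psi_series z)"
proof -
  let ?f = "\<lambda>(m, n). of_real (p ^ m / poch m) * (- (of_real (p ^ m) * z)) ^ n"
  \<comment> \<open>A majorant of product form: replacing \<open>p^m z\<close> by \<open>z\<close>
    separates the two indices.\<close>
  let ?g = "\<lambda>(m, n). of_real (p ^ m / poch m) * of_real (norm z ^ n) :: complex"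
  have w_nonneg: "0 \<le> p ^ m / poch m" for m
    using p_pos poch_pos[of m] by simp
  have a: "(\<lambda>m. of_real (p ^ m / poch m) :: complex) summable_on UNIV"
    using summable_weights w_nonneg
    by (intro summable_on_of_real summable_nonneg_imp_summable_on)
  have b: "(\<lambda>n. of_real (norm z ^ n) :: complex) summable_on UNIV"
    using assms by (intro summable_on_of_real summable_nonneg_imp_summable_on summable_geometric) auto
  have "?g summable_on UNIV"
    by (rule has_sum_imp_summable[OF has_sum_product[OF has_sum_infsum[OF a] has_sum_infsum[OF b]]])
  then have "(\<lambda>x. norm (?g x)) summable_on UNIV"
    by (simp only: summable_on_iff_abs_summable_on_complex)
  then have "(\<lambda>x. norm (?f x)) summable_on UNIV"
  proof (rule Infinite_Sum.abs_summable_on_comparison_test)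
    fix x :: "nat \<times> nat"
    obtain m n where x: "x = (m, n)" by (cases x)
    have "norm (of_real (p ^ m) * z) ^ n \<le> norm z ^ n"
      by (intro power_mono norm_p_power_mult_le norm_ge_zero)
    then have "\<bar>p ^ m / poch m\<bar> * norm (of_real (p ^ m) * z) ^ n \<le> \<bar>p ^ m / poch m\<bar> * norm z ^ n"
      by (intro mult_left_mono) auto
    then show "norm (?f x) \<le> norm (?g x)"
      unfolding x case_prod_conv norm_mult norm_of_real norm_power norm_minus_cancel by simp
  qed
  then have "?f summable_on UNIV"
    by (simp only: summable_on_iff_abs_summable_on_complex)
  then have total: "(?f has_sum infsum ?f UNIV) (UNIV \<times> UNIV)"
    by simp
  have geo: "((\<lambda>n. of_real (p ^ m / poch m) * (- (of_real (p ^ m) * z)) ^ n) has_sum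
      of_real (p ^ m / poch m) * psi (of_real (p ^ m) * z)) UNIV" for m
  proof (rule has_sum_cmult_right)
    let ?u = "- (of_real (p ^ m) * z)"
    have "norm ?u < 1"
      using norm_p_power_mult_le[of m z] assms by simp
    then have "(\<lambda>n. ?u ^ n) sums (1 / (1 - ?u))" "summable (\<lambda>n. norm (?u ^ n))"
      unfolding norm_power by (intro geometric_sums summable_geometric; simp only: real_norm_def abs_norm_cancel)+
    then show "((\<lambda>n. ?u ^ n) has_sum psi (of_real (p ^ m) * z)) UNIV"
      unfolding psi_def by (intro norm_summable_imp_has_sum) simp_all
  qed
  have "((\<lambda>m. of_real (p ^ m / poch m) * psi (of_real (p ^ m) * z)) has_sum infsum ?f UNIV) UNIV"
    by (rule has_sum_SigmaD[OF total]) (simp only: case_prod_conv geo)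
  then have series: "psi_series z = infsum ?f UNIV"
    unfolding psi_series_def by (intro sums_unique[symmetric] has_sum_imp_sums)
  have col: "((\<lambda>m. of_real (p ^ m / poch m) * (- (of_real (p ^ m) * z)) ^ n) has_sum
      (eul_inv (of_real (p ^ Suc n)) * (- z) ^ n)) UNIV" for n
  proof -
    have "norm (of_real (p ^ Suc n) :: complex) < 1"
      unfolding norm_of_real using p_pos p_power_less_1[of "Suc n"] by simp
    then have "((\<lambda>m. of_real (1 / poch m) * of_real (p ^ Suc n) ^ m * (- z) ^ n) has_sum
      (eul_inv (of_real (p ^ Suc n)) * (- z) ^ n)) UNIV"
      by (intro has_sum_cmult_left eul_inv_has_sum)
    also have "(\<lambda>m. of_real (1 / poch m) * of_real (p ^ Suc n) ^ m * (- z) ^ n) =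
      (\<lambda>m. of_real (p ^ m / poch m) * (- (of_real (p ^ m) * z)) ^ n)"
    proof
      fix m
      have "(- (of_real (p ^ m) * z)) ^ n = of_real ((p ^ m) ^ n) * (- z) ^ n"
        by (simp flip: power_mult_distrib)
      moreover have "(p ^ Suc n) ^ m = p ^ m * (p ^ m) ^ n"
        by (simp add: power_mult_distrib mult.commute flip: power_mult)
      ultimately show "of_real (1 / poch m) * of_real (p ^ Suc n) ^ m * (- z) ^ n =
          of_real (p ^ m / poch m) * (- (of_real (p ^ m) * z)) ^ n"
        by (simp flip: of_real_power del: power_Suc)
    qed
    finally show ?thesis .
  qed
  have "((\<lambda>n. eul_inv (of_real (p ^ Suc n)) * (- z) ^ n) has_sum psi_series z) UNIV"
    unfolding series
    by (rule has_sum_SigmaD[OF total[unfolded has_sum_swap[of ?f]]]) (simp only: case_prod_conv col)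
  then have "((\<lambda>n. poch_inf * (eul_inv (of_real (p ^ Suc n)) * (- z) ^ n)) has_sum poch_inf * psi_series z) UNIV"
    by (rule has_sum_cmult_right)
  then show ?thesis
    by (intro has_sum_imp_sums) (simp only: poch_eq_eul_inv mult.assoc)
qed

section \<open>Identification of phi with the series in psi\<close>

lemma qfact_eq: "qfact p n = poch n / (1 - p) ^ n"
proof (induction n)
  case (Suc n)
  have "qfact p (Suc n) = qfact p n * qnum p (Suc n)"
    by (simp add: qfact_def)
  also have "qnum p (Suc n) = (1 - p ^ Suc n) / (1 - p)"
    unfolding qnum_def using p_less_1 by (simp add: divide_simps) (simp add: algebra_simps)
  finally show ?case
    by (simp add: Suc poch_Suc)
qed (simp add: qfact_def)

lemma not_phi_poles_iff: "\<xi> \<notin> phi_poles (1 / p) \<longleftrightarrow> \<xi> / of_real (1 - p) \<in> psi_regular"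
proof -
  have nz: "of_real (1 - p) \<noteq> (0 :: complex)"
    unfolding of_real_eq_0_iff using p_less_1 by simp
  have "\<xi> = of_real ((1 / (1 / p) - 1) * (1 / p) ^ k) \<longleftrightarrow> 1 + of_real (p ^ k) * (\<xi> / of_real (1 - p)) = 0" for k
  proof -
    have "1 + of_real (p ^ k) * (\<xi> / of_real (1 - p)) = 0 \<longleftrightarrow> of_real (p ^ k) * \<xi> = - of_real (1 - p)"
      using nz by (simp add: add_eq_0_iff divide_eq_eq)
    also have "\<dots> \<longleftrightarrow> \<xi> = - of_real (1 - p) / of_real (p ^ k)"
      by (simp add: eq_divide_eq mult.commute)
    also have "- of_real (1 - p) / of_real (p ^ k) = (of_real ((1 / (1 / p) - 1) * (1 / p) ^ k) :: complex)"
      by (simp add: power_divide)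
    finally show ?thesis by simp
  qed
  then show ?thesis
    unfolding phi_poles_def psi_regular_def by auto
qed

text \<open>The right-hand side satisfies the description under \<open>SOME\<close>, so the chosen
  \<open>phi\<close> satisfies it as well. Both have the same power series on the disc of radius
  \<open>1 - p\<close>, and the identity theorem extends the equality.\<close>

lemma phi_eq:
  assumes "\<xi> \<notin> phi_poles (1 / p)"
  shows "phi (1 / p) \<xi> = poch_inf * psi_series (\<xi> / of_real (1 - p))"
proof -
  define F where "F = (\<lambda>\<xi>. poch_inf * psi_series (\<xi> / of_real (1 - p)))"
  let ?P = "\<lambda>f. f holomorphic_on (- phi_poles (1 / p)) \<and>
      (\<forall>\<xi>. norm \<xi> < 1 - p \<longrightarrow> (\<lambda>n. (-1) ^ n * of_real (qfact p n) * \<xi> ^ n) sums f \<xi>)"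
  have nz: "of_real (1 - p) \<noteq> (0 :: complex)"
    unfolding of_real_eq_0_iff using p_less_1 by simp
  have regular: "- phi_poles (1 / p) = {\<xi>. \<xi> / of_real (1 - p) \<in> psi_regular}"
    using not_phi_poles_iff by auto
  have "psi_series \<circ> (\<lambda>\<xi>. \<xi> / of_real (1 - p)) holomorphic_on (- phi_poles (1 / p))"
    by (rule holomorphic_on_compose_gen[OF _ holomorphic_psi_series])
      (auto intro!: holomorphic_intros nz simp: not_phi_poles_iff)
  then have "F holomorphic_on (- phi_poles (1 / p))"
    unfolding F_def o_def by (intro holomorphic_intros)
  moreover have "(\<lambda>n. (-1) ^ n * of_real (qfact p n) * \<xi> ^ n) sums F \<xi>" if "norm \<xi> < 1 - p" for \<xi>
  proof -
    have "norm (\<xi> / of_real (1 - p)) < 1"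
      unfolding norm_divide norm_of_real using that p_less_1 by simp
    from psi_series_power_series[OF this]
    have "(\<lambda>n. of_real (poch n) * (- (\<xi> / of_real (1 - p))) ^ n) sums F \<xi>"
      unfolding F_def .
    moreover have "of_real (poch n) * (- (\<xi> / of_real (1 - p))) ^ n = (-1) ^ n * of_real (qfact p n) * \<xi> ^ n" for n
      unfolding qfact_eq by (subst power_minus) (simp add: power_divide)
    ultimately show ?thesis by simp
  qed
  ultimately have F: "?P F" by blast
  have "phi (1 / p) = (SOME f. ?P f)"
    unfolding phi_def by simp
  then have P: "?P (phi (1 / p))"
    using someI[of ?P F, OF F] by simp
  have "phi (1 / p) \<xi> = F \<xi>"
  proof (rule analytic_continuation_open[where f = "phi (1 / p)" and g = F and s = "ball 0 (1 - p)" and s' = "- phi_poles (1 / p)"])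
    have "continuous_on UNIV (\<lambda>\<xi>. \<xi> / of_real (1 - p) :: complex)"
      using nz by (intro continuous_intros) auto
    then have "open ((\<lambda>\<xi>. \<xi> / of_real (1 - p)) -` psi_regular)"
      by (rule open_vimage[OF open_psi_regular])
    then show "open (- phi_poles (1 / p))"
      unfolding regular vimage_def .
    \<comment> \<open>The poles form a countable set, and the complement of such a set in the plane
      is path-connected.\<close>
    have "phi_poles (1 / p) = range (\<lambda>k. of_real ((1 / (1 / p) - 1) * (1 / p) ^ k))"
      unfolding phi_poles_def by auto
    then have "countable (phi_poles (1 / p))" by simp
    then show "connected (- phi_poles (1 / p))"
      by (intro path_connected_imp_connected path_connected_complement_countable) simp_all
    show "ball 0 (1 - p) \<subseteq> - phi_poles (1 / p)"
    proof
      fix \<xi> :: complex assume "\<xi> \<in> ball 0 (1 - p)"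
      then have "norm (\<xi> / of_real (1 - p)) < 1"
        unfolding norm_divide norm_of_real using p_less_1 by simp
      then have "norm (of_real (p ^ m) * (\<xi> / of_real (1 - p))) < 1" for m
        using norm_p_power_mult_le[of m "\<xi> / of_real (1 - p)"] by linarith
      then have "1 + of_real (p ^ m) * (\<xi> / of_real (1 - p)) \<noteq> 0" for m
        by (metis add_eq_0_iff norm_minus_cancel norm_one less_irrefl)
      then show "\<xi> \<in> - phi_poles (1 / p)"
        by (simp add: not_phi_poles_iff psi_regular_def)
    qed
    fix \<xi> :: complex assume "\<xi> \<in> ball 0 (1 - p)"
    then have "norm \<xi> < 1 - p" by simp
    with P F show "phi (1 / p) \<xi> = F \<xi>"
      by (intro sums_unique2) blast+
  next
    show "phi (1 / p) holomorphic_on - phi_poles (1 / p)" "F holomorphic_on - phi_poles (1 / p)"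
      using P F by blast+
  qed (use assms p_less_1 in simp_all)
  then show ?thesis unfolding F_def .
qed


subsection \<open>The discrete sums\<close>

text \<open>Passing to base \<open>p\<close> turns \<open>[n]_q\<close> into
  \<open>(1 - p^n) / (p^(n-1) (1 - p))\<close>; in the factorial the powers of \<open>p\<close>
  accumulate to \<open>gauss n\<close>.\<close>

lemma qexp_eq: "qexp (1 / p) x = eul (of_real (1 - p) * x)"
proof -
  have "qfact (1 / p) n = poch n / (gauss (int n) * (1 - p) ^ n)" for n
  proof (induction n)
    case (Suc n)
    have "qfact (1 / p) (Suc n) = qfact (1 / p) n * qnum (1 / p) (Suc n)"
      by (simp add: qfact_def)
    also have "qnum (1 / p) (Suc n) = (1 - p ^ Suc n) / (p ^ n * (1 - p))"
    proof -
      have "(1 / p) ^ Suc n - 1 = (1 - p ^ Suc n) / (p * p ^ n)"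
        by (simp add: power_divide diff_divide_distrib)
      moreover have "1 / p - 1 = (1 - p) / p"
        by (simp add: diff_divide_distrib)
      ultimately show ?thesis
        unfolding qnum_def using p_less_1 by simp
    qed
    finally show ?case
      using gauss_Suc[of "int n"] by (simp add: Suc poch_Suc add.commute mult_ac)
  qed (simp add: qfact_def)
  then have "x ^ n / of_real (qfact (1 / p) n) =
      of_real (gauss (int n) / poch n) * (of_real (1 - p) * x) ^ n" for n
    by (simp add: power_mult_distrib)
  then show ?thesis
    unfolding qexp_def eul_def by simp
qed

lemma psi_bounded:
  assumes "z \<in> psi_regular"
  shows "\<exists>C. \<forall>m. norm (psi (of_real (p ^ m) * z)) \<le> C"
proof -
  from psi_locally_bounded[OF assms] obtain r C where "0 < r" "cball z r \<subseteq> psi_regular"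
    and C: "\<And>m u. u \<in> cball z r \<Longrightarrow> norm (psi (of_real (p ^ m) * u)) \<le> C"
    by blast
  then show ?thesis
    by (intro exI[of _ C] allI C) simp
qed

lemma psi_series_has_sum:
  assumes "z \<in> psi_regular"
  shows "((\<lambda>m. of_real (p ^ m / poch m) * psi (of_real (p ^ m) * z)) has_sum psi_series z) UNIV"
proof -
  obtain C where C: "\<And>m. norm (psi (of_real (p ^ m) * z)) \<le> C"
    using psi_bounded[OF assms] by blast
  have "norm (of_real (p ^ m / poch m) * psi (of_real (p ^ m) * z)) \<le> p ^ m / poch m * C" for m
    unfolding norm_mult norm_of_real using C[of m] p_pos poch_pos[of m]
    by (intro mult_mono) auto
  then have s: "summable (\<lambda>m. norm (of_real (p ^ m / poch m) * psi (of_real (p ^ m) * z)))"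
    by (intro summable_comparison_test'[OF summable_mult2[OF summable_weights, of C], of 0])
      simp
  show ?thesis
    unfolding psi_series_def
    by (rule norm_summable_imp_has_sum[OF s summable_sums[OF summable_norm_cancel[OF s]]])
qed

text \<open>Nonnegative exponents are covered by \<open>psi_bounded\<close>. Negative ones are
  reduced to the same lemma at \<open>1 / l\<close> by the reflection
  \<open>psi (1 / u) = 1 - psi u\<close>.\<close>

lemma psi_bounded_on_spiral:
  assumes "l \<noteq> 0" and "\<And>k. 1 + of_real (p powi k) * l \<noteq> 0"
  obtains C where "\<And>k. norm (psi (of_real (p powi k) * l)) \<le> C"
proof -
  have "l \<in> psi_regular"
    using assms(2)[of "int m" for m] by (simp add: psi_regular_def)
  then obtain C where C: "\<And>m. norm (psi (of_real (p ^ m) * l)) \<le> C"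
    using psi_bounded by blast
  have inverse: "of_real (p powi (- int m)) * l = 1 / (of_real (p ^ m) * (1 / l))" for m
    by (simp add: power_int_minus field_simps)
  have "1 + of_real (p ^ m) * (1 / l) \<noteq> 0" for m
  proof
    assume "1 + of_real (p ^ m) * (1 / l) = 0"
    then have "of_real (p ^ m) * (1 / l) = - 1"
      by (metis add_eq_0_iff)
    then have "of_real (p powi (- int m)) * l = - 1"
      unfolding inverse by simp
    then show False using assms(2)[of "- int m"] by simp
  qed
  then have "1 / l \<in> psi_regular"
    by (simp add: psi_regular_def)
  then obtain C' where C': "\<And>m. norm (psi (of_real (p ^ m) * (1 / l))) \<le> C'"
    using psi_bounded by blast
  have reflect: "psi (1 / u) = 1 - psi u" if "u \<noteq> 0" "1 + u \<noteq> 0" for u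
    using that unfolding psi_def by (simp add: divide_simps) (simp add: algebra_simps)
  have neg: "norm (psi (of_real (p powi (- int m)) * l)) \<le> 1 + C'" for m
  proof -
    have eq: "psi (of_real (p powi (- int m)) * l) = 1 - psi (of_real (p ^ m) * (1 / l))"
      unfolding inverse using assms(1) \<open>1 + of_real (p ^ m) * (1 / l) \<noteq> 0\<close> by (intro reflect) auto
    then show ?thesis
      using norm_triangle_ineq4[of 1 "psi (of_real (p ^ m) * (1 / l))"] C'[of m]
      unfolding eq norm_one by linarith
  qed
  show ?thesis
  proof (rule that)
    show "norm (psi (of_real (p powi k) * l)) \<le> max C (1 + C')" for k
    proof (cases k rule: int_cases2)
      case (nonneg m)
      then show ?thesis using C[of m] by simp
    next
      case (nonpos m)
      then show ?thesis using neg[of m] by simp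
    qed
  qed
qed

lemma spiral_regular:
  assumes "\<And>k. 1 + of_real (p powi k) * l \<noteq> 0"
  shows "of_real (p powi n) * l \<in> psi_regular"
proof -
  have "of_real (p ^ m) * (of_real (p powi n) * l) = of_real (p powi (n + int m)) * l" for m
    by (simp add: power_int_add)
  then show ?thesis
    unfolding psi_regular_def mem_Collect_eq using assms by metis
qed

lemma theta_scale_nz:
  assumes "a \<noteq> 0" and "theta p a \<noteq> 0"
  shows "theta p (of_real (p powi n) * a) \<noteq> 0"
  using theta_scale[OF assms(1), of n] assms(2) by auto

text \<open>Both sides, up to the factor \<open>poch_inf\<close>, sum one absolutely convergent
  double family. Its rows give \<open>psi_series\<close>; after the shift of \<open>n\<close> by
  \<open>m\<close>, its columns are evaluated by \<open>sum_inverse_theta\<close>.\<close>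

lemma discrete_sums_eq:
  assumes l: "l \<noteq> 0" "\<And>k. 1 + of_real (p powi k) * l \<noteq> 0"
    and a: "a \<noteq> 0" "theta p a \<noteq> 0"
  shows "(\<Sum>\<^sub>\<infinity>n. of_real (p powi n) * psi (of_real (p powi n) * l) / eul (of_real (p powi n) * a)) =
    (\<Sum>\<^sub>\<infinity>n. of_real (p powi n) * (poch_inf * psi_series (of_real (p powi n) * l)) / theta p (of_real (p powi n) * a))"
proof -
  let ?c = "\<lambda>m. of_real (p ^ m / poch m) :: complex"
  let ?t = "\<lambda>n. of_real (p powi n) / theta p (of_real (p powi n) * a)"
  let ?f = "\<lambda>(n, m). ?t n * (?c m * psi (of_real (p powi (n + int m)) * l))"
  obtain C where C: "\<And>k. norm (psi (of_real (p powi k) * l)) \<le> C"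
    using psi_bounded_on_spiral[OF l] by blast
  \<comment> \<open>By quasi-periodicity these are, up to a constant, the terms of the theta series
    at \<open>p a\<close>, hence summable.\<close>
  have t: "?t = (\<lambda>n. of_real (gauss n) * (of_real p * a) powi n * (1 / theta p a))"
  proof
    fix n
    have "theta p a = of_real (gauss n) * a powi n * theta p (of_real (p powi n) * a)"
      by (rule theta_scale[OF a(1)])
    then show "?t n = of_real (gauss n) * (of_real p * a) powi n * (1 / theta p a)"
      using a theta_scale_nz[OF a, of n] by (simp add: power_int_mult_distrib)
  qed
  have t_sum: "?t summable_on UNIV"
    unfolding t by (intro summable_on_cmult_left has_sum_imp_summable[OF theta_has_sum])
  have c_nonneg: "0 \<le> p ^ m / poch m" for m
    using p_pos poch_pos[of m] by simp
  have c_sum: "?c summable_on UNIV"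
    using summable_weights c_nonneg by (intro summable_on_of_real summable_nonneg_imp_summable_on)
  have "(\<lambda>(n, m). ?t n * ?c m) summable_on UNIV"
    by (rule has_sum_imp_summable[OF has_sum_product[OF has_sum_infsum[OF t_sum] has_sum_infsum[OF c_sum]]])
  then have "(\<lambda>x. norm (case x of (n, m) \<Rightarrow> ?t n * ?c m)) summable_on UNIV"
    by (simp only: summable_on_iff_abs_summable_on_complex)
  then have "(\<lambda>x. norm (case x of (n, m) \<Rightarrow> ?t n * ?c m) * C) summable_on UNIV"
    by (rule summable_on_cmult_left)
  then have "(\<lambda>x. norm (?f x)) summable_on UNIV"
  proof (rule Infinite_Sum.abs_summable_on_comparison_test')
    fix x :: "int \<times> nat"
    obtain n m where x: "x = (n, m)" by (cases x)
    show "norm (?f x) \<le> norm (case x of (n, m) \<Rightarrow> ?t n * ?c m) * C"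
      unfolding x case_prod_conv mult.assoc[symmetric] by (subst norm_mult) (intro mult_left_mono C norm_ge_zero)
  qed
  then have "?f summable_on UNIV"
    by (simp only: summable_on_iff_abs_summable_on_complex)
  then have total: "(?f has_sum infsum ?f UNIV) UNIV"
    by simp
  have row: "((\<lambda>m. ?t n * (?c m * psi (of_real (p powi (n + int m)) * l))) has_sum
      ?t n * psi_series (of_real (p powi n) * l)) UNIV" for n
  proof (rule has_sum_cmult_right)
    have *: "of_real (p ^ m) * (of_real (p powi n) * l) = of_real (p powi (n + int m)) * l" for m
      by (simp add: power_int_add mult_ac)
    from psi_series_has_sum[OF spiral_regular[OF l(2), of n]]
    show "((\<lambda>m. ?c m * psi (of_real (p powi (n + int m)) * l)) has_sum psi_series (of_real (p powi n) * l)) UNIV"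
      unfolding * .
  qed
  have "(?f has_sum infsum ?f UNIV) (UNIV \<times> UNIV)"
    using total by (subst UNIV_Times_UNIV)
  then have "((\<lambda>n. ?t n * psi_series (of_real (p powi n) * l)) has_sum infsum ?f UNIV) UNIV"
    by (rule has_sum_SigmaD) (simp only: case_prod_conv row)
  then have R: "((\<lambda>n. poch_inf * (?t n * psi_series (of_real (p powi n) * l))) has_sum poch_inf * infsum ?f UNIV) UNIV"
    by (rule has_sum_cmult_right)
  \<comment> \<open>After replacing \<open>n\<close> by \<open>n - m\<close>, the argument of
    \<open>psi\<close> is \<open>p^n l\<close>, independent of \<open>m\<close>.\<close>
  have "(?f has_sum infsum ?f UNIV) UNIV \<longleftrightarrow>
      ((\<lambda>(n, m). ?f (n - int m, m)) has_sum infsum ?f UNIV) UNIV"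
    by (rule has_sum_reindex_bij_witness[of _ "\<lambda>(n, m). (n - int m, m)" "\<lambda>(n, m). (n + int m, m)"]) auto
  with total have total': "((\<lambda>(n, m). ?f (n - int m, m)) has_sum infsum ?f UNIV) (UNIV \<times> UNIV)"
    by simp
  have col: "((\<lambda>m. ?f (n - int m, m)) has_sum
      of_real (p powi n) * psi (of_real (p powi n) * l) * (1 / (poch_inf * eul (of_real (p powi n) * a)))) UNIV" for n
  proof -
    let ?b = "of_real (p powi n) * a"
    have "?f (n - int m, m) = of_real (p powi n) * psi (of_real (p powi n) * l) *
        (of_real (1 / poch m) / theta p (of_real (p powi (- int m)) * ?b))" for m
    proof -
      have 1: "of_real (p powi (n - int m)) * a = of_real (p powi (- int m)) * ?b"
        using power_int_add[of p "- int m" n] by simp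
      have 2: "of_real (p powi (n - int m)) * of_real (p ^ m) = (of_real (p powi n) :: complex)"
      proof -
        have "p powi n = p powi (n - int m) * p ^ m"
          using power_int_add[of p "n - int m" "int m"] by simp
        then show ?thesis by (metis of_real_mult)
      qed
      have "u / th * (of_real (v / c) * y) = u * of_real v * y * (of_real (1 / c) / th)"
        for u th y :: complex and v c by (simp add: mult_ac)
      then show ?thesis
        unfolding case_prod_conv 1 diff_add_cancel by (simp only: 2)
    qed
    then show ?thesis
      using a by (simp only:) (intro has_sum_cmult_right sum_inverse_theta theta_scale_nz, simp_all)
  qed
  have "((\<lambda>n. of_real (p powi n) * psi (of_real (p powi n) * l) * (1 / (poch_inf * eul (of_real (p powi n) * a))))
      has_sum infsum ?f UNIV) UNIV"
    by (rule has_sum_SigmaD[OF total']) (use col in \<open>simp only: case_prod_conv\<close>)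
  then have L: "((\<lambda>n. poch_inf * (of_real (p powi n) * psi (of_real (p powi n) * l) * (1 / (poch_inf * eul (of_real (p powi n) * a)))))
      has_sum poch_inf * infsum ?f UNIV) UNIV"
    by (rule has_sum_cmult_right)
  from infsumI[OF L] infsumI[OF R] show ?thesis
    by (simp add: mult_ac)
qed

lemma jackson_integral_eq:
  "jackson_integral p \<alpha> f = of_real (1 - p) * \<alpha> * (\<Sum>\<^sub>\<infinity>n. of_real (p powi n) * f (of_real (p powi n) * \<alpha>))"
  by (simp add: jackson_integral_def mult.commute)

lemma Euler_disc_eq:
  assumes l: "l \<noteq> 0" "\<And>k. 1 + of_real (p powi k) * l \<noteq> 0"
    and x: "x \<noteq> 0" "\<And>k. x \<noteq> - (of_real (1 - p) * l * of_real (p powi k))"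
  shows "Euler_exp_disc (1 / p) l x = Euler_theta_disc (1 / p) l x"
proof -
  have nz: "of_real (1 - p) \<noteq> (0 :: complex)"
    unfolding of_real_eq_0_iff using p_less_1 by simp
  \<comment> \<open>At the n-th sample point both \<open>eul\<close> and \<open>theta\<close> have
    argument \<open>p^n a\<close>: the factor \<open>1 - p\<close> comes from \<open>qexp_eq\<close>
    on one side and from the base point \<open>(1 - p) l\<close> on the other.\<close>
  define a where "a = of_real (1 - p) * l / (of_real p * x)"
  have a: "a \<noteq> 0"
    using l(1) x(1) nz by (simp add: a_def)
  have inv: "1 / (1 / p) = p" by simp
  have "theta p a \<noteq> 0"
  proof (rule theta_nz[OF a])
    show "of_real (p powi m) * a \<noteq> - 1" for m
    proof
      assume "of_real (p powi m) * a = - 1"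
      then have "of_real (p powi m) * (of_real (1 - p) * l) = - (of_real p * x)"
        using x(1) by (simp add: a_def divide_eq_eq)
      \<comment> \<open>The denominator of \<open>a\<close> contains \<open>p\<close>, so a zero of
        theta at exponent \<open>m\<close> matches the excluded \<open>x\<close> with exponent
        \<open>m - 1\<close>.\<close>
      moreover have "of_real (p powi m) = of_real p * (of_real (p powi (m - 1)) :: complex)"
        using power_int_add[of p 1 "m - 1"] by (simp flip: of_real_mult of_real_power_int)
      ultimately have "of_real p * x = of_real p * - (of_real (1 - p) * l * of_real (p powi (m - 1)))"
        by (simp add: mult_ac)
      then have "x = - (of_real (1 - p) * l * of_real (p powi (m - 1)))"
        unfolding mult_cancel_left by simp
      with x(2) show False by blast
    qed
  qed
  note core = discrete_sums_eq[OF l a this]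
  have arg: "of_real (1 - p) * (of_real (1 / p) * (of_real (p powi n) * l) / x) = of_real (p powi n) * a"
    "of_real (1 / p) * (of_real (p powi n) * (of_real (1 - p) * l)) / x = of_real (p powi n) * a" for n
    by (simp_all add: a_def mult_ac)
  have phi: "phi (1 / p) (of_real (p powi n) * (of_real (1 - p) * l)) =
      poch_inf * psi_series (of_real (p powi n) * l)" for n
  proof -
    have z: "of_real (p powi n) * (of_real (1 - p) * l) / of_real (1 - p) = of_real (p powi n) * l"
      using nz by simp
    show ?thesis
      using phi_eq not_phi_poles_iff z spiral_regular[OF l(2), of n] by metis
  qed
  have "Euler_exp_disc (1 / p) l x = of_real (1 / p) * (of_real (1 - p) * l) *
      (\<Sum>\<^sub>\<infinity>n. of_real (p powi n) * psi (of_real (p powi n) * l) / eul (of_real (p powi n) * a))"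
    unfolding Euler_exp_disc_def inv qexp_eq jackson_integral_eq arg
    by (simp only: times_divide_eq_right mult.assoc)
  also have "\<dots> = of_real (1 / p) * (of_real (1 - p) * l) *
    (\<Sum>\<^sub>\<infinity>n. of_real (p powi n) * (poch_inf * psi_series (of_real (p powi n) * l)) / theta p (of_real (p powi n) * a))"
    unfolding core ..
  also have "\<dots> = Euler_theta_disc (1 / p) l x"
  proof -
    have "1 / p / (1 - p) * (1 - p) = 1 / p"
      using p_less_1 by simp
    then have "of_real (1 / p / (1 - p)) * (of_real (1 - p) * u) = (of_real (1 / p) * u :: complex)" for u
      by (metis of_real_mult mult.assoc)
    then show ?thesis
      unfolding Euler_theta_disc_def inv jackson_integral_eq arg phi
      by (simp only: times_divide_eq_right mult.assoc)
  qed
  finally show ?thesis .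
qed

end

subsection \<open>The integrals along rays\<close>

text \<open>The bound is the distance from -1 to the line through 0 in direction \<open>d\<close>,
  which is the absolute value of \<open>sin d\<close>. If this vanishes, the ray is the positive
  real axis and 1 is a bound.\<close>

lemma cis_plus_one_lower_bound:
  assumes "d \<in> {-pi<..<pi}"
  obtains c where "0 < c" "\<And>t. 0 \<le> t \<Longrightarrow> c \<le> norm (1 + of_real t * cis d)"
proof (cases "sin d = 0")
  case True
  then have "d = 0"
    using assms sin_gt_zero[of d] sin_lt_zero[of "d + 2 * pi"] by (cases d "0 :: real" rule: linorder_cases) auto
  have "1 \<le> norm (1 + of_real t * cis d)" if "0 \<le> t" for t
    using that complex_Re_le_cmod[of "1 + of_real t * cis d"] \<open>d = 0\<close> by simp
  then show ?thesis using that[of 1] by simp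
next
  case False
  have expand: "(1 + t * x)\<^sup>2 + (t * y)\<^sup>2 = 1 + 2 * t * x + t\<^sup>2 * (x\<^sup>2 + y\<^sup>2)" for t x y :: real
    by (simp add: power2_eq_square algebra_simps)
  have "\<bar>sin d\<bar> \<le> norm (1 + of_real t * cis d)" for t
  proof (rule power2_le_imp_le)
    have "(norm (1 + of_real t * cis d))\<^sup>2 = (1 + t * cos d)\<^sup>2 + (t * sin d)\<^sup>2"
      by (simp add: cmod_power2)
    also have "\<dots> = 1 + 2 * t * cos d + t\<^sup>2 * ((cos d)\<^sup>2 + (sin d)\<^sup>2)"
      by (rule expand)
    also have "\<dots> = ((cos d)\<^sup>2 + (sin d)\<^sup>2) + 2 * t * cos d + t\<^sup>2"
      by simp
    also have "\<dots> = (sin d)\<^sup>2 + (t + cos d)\<^sup>2"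
      by (simp only: power2_eq_square algebra_simps)
    finally show "\<bar>sin d\<bar>\<^sup>2 \<le> (norm (1 + of_real t * cis d))\<^sup>2"
      by simp
  qed simp
  then show ?thesis using that[of "\<bar>sin d\<bar>"] False by simp
qed

text \<open>Continuity bounds \<open>(1 + t^2) u\<close> on a compact interval, and the functional
  equation transports the bounds: inward for \<open>u\<close>, outward for
  \<open>t^2 u\<close>.\<close>

lemma rescaling_decay:
  fixes u :: "real \<Rightarrow> real"
  assumes p: "0 < p" "p < 1" and cont: "continuous_on {0<..} u"
    and nonneg: "\<And>t. 0 < t \<Longrightarrow> 0 \<le> u t"
    and rec: "\<And>t. 0 < t \<Longrightarrow> u (p * t) = t * u t"
  shows "\<exists>M. \<forall>t>0. u t \<le> M * inverse (1 + t\<^sup>2)"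
proof -
  \<comment> \<open>The interval reaches up to \<open>1 / p^2\<close> because an outward step from
    \<open>p t\<close> to \<open>t\<close> does not increase \<open>t^2 u t\<close> once
    \<open>p^2 t\<close> is at least 1.\<close>
  let ?K = "{p .. 1 / p\<^sup>2}"
  have p2: "p\<^sup>2 < 1"
    using p by (simp add: power_less_one_iff)
  have "continuous_on ?K (\<lambda>t. (1 + t\<^sup>2) * u t)"
    using p by (intro continuous_intros continuous_on_subset[OF cont]) auto
  then have "bounded ((\<lambda>t. (1 + t\<^sup>2) * u t) ` ?K)"
    by (intro compact_imp_bounded compact_continuous_image) auto
  then obtain B where "\<forall>t\<in>?K. \<bar>(1 + t\<^sup>2) * u t\<bar> \<le> B"
    by (auto simp: bounded_iff)
  then have B: "\<And>t. t \<in> ?K \<Longrightarrow> \<bar>(1 + t\<^sup>2) * u t\<bar> \<le> B"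
    by blast
  have K: "u t \<le> B" "t\<^sup>2 * u t \<le> B" if "t \<in> ?K" for t
  proof -
    have "0 < t" using that p by auto
    then have "0 \<le> u t" "0 \<le> t\<^sup>2 * u t" using nonneg by simp_all
    moreover have "u t + t\<^sup>2 * u t \<le> B"
      using B[OF that] by (simp add: algebra_simps)
    ultimately show "u t \<le> B" "t\<^sup>2 * u t \<le> B" by linarith+
  qed
  \<comment> \<open>With \<open>t = p s\<close> and \<open>s\<close> at most 1,
    \<open>u t = s * u s\<close> is at most \<open>u s\<close>.\<close>
  have small: "u t \<le> B" if "p ^ Suc n \<le> t" "t \<le> 1" for n t
    using that
  proof (induction n arbitrary: t)
    case 0
    have "1 \<le> 1 / p\<^sup>2" using p p2 by simp
    with 0 show ?case by (intro K) auto
  next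
    case (Suc n)
    show ?case
    proof (cases "p ^ Suc n \<le> t")
      case True
      then show ?thesis using Suc by blast
    next
      case False
      define s where "s = t / p"
      have t: "t = p * s" using p by (simp add: s_def)
      have "p ^ Suc n \<le> p"
        using p power_le_one[of p n] by (simp add: mult_le_cancel_left1)
      with False have "t \<le> p" by linarith
      then have s: "p ^ Suc n \<le> s" "s \<le> 1"
        using Suc.prems(1) p by (simp_all add: s_def field_simps)
      have "0 < s"
        using s(1) p by (meson less_le_trans zero_less_power)
      then have "u t = s * u s"
        unfolding t by (rule rec)
      also have "\<dots> \<le> u s"
        using s(2) \<open>0 < s\<close> nonneg[of s] by (simp add: mult_left_le_one_le)
      also have "\<dots> \<le> B" using Suc.IH s by blast
      finally show ?thesis .
    qed
  qed
  have large: "t\<^sup>2 * u t \<le> B" if "1 \<le> t" "p ^ Suc n * t \<le> 1" for n t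
    using that
  proof (induction n arbitrary: t)
    case 0
    have "p\<^sup>2 \<le> p"
      using p by (simp add: power2_eq_square mult_left_le_one_le)
    then have "p\<^sup>2 * t \<le> p * t"
      using 0 by (intro mult_right_mono) auto
    also have "\<dots> \<le> 1" using 0 by simp
    finally have "t \<le> 1 / p\<^sup>2" using p by (simp add: field_simps)
    with 0 p show ?case by (intro K) auto
  next
    case (Suc n)
    show ?case
    proof (cases "p\<^sup>2 * t \<le> 1")
      case True
      then have "t \<le> 1 / p\<^sup>2" using p by (simp add: field_simps)
      with Suc.prems p show ?thesis by (intro K) auto
    next
      case False
      define s where "s = p * t"
      have ps: "1 \<le> p * s" using False by (simp add: s_def power2_eq_square mult.assoc)
      have "0 < s"
        using p Suc.prems by (simp add: s_def)
      then have "p * s \<le> 1 * s"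
        using p by (intro mult_right_mono) auto
      with ps have "1 \<le> s" by simp
      moreover have "p ^ Suc n * s \<le> 1"
        using Suc.prems(2) by (simp add: s_def mult_ac)
      ultimately have IH: "s\<^sup>2 * u s \<le> B" by (rule Suc.IH)
      have "t\<^sup>2 * u t = s / p * u s"
        using rec[of t] Suc.prems(1) p by (simp add: s_def power2_eq_square)
      also have "s / p * u s \<le> s\<^sup>2 * u s"
      proof (rule mult_right_mono)
        have "s * 1 \<le> s * (p * s)"
          using ps \<open>0 < s\<close> by (intro mult_left_mono) auto
        then show "s / p \<le> s\<^sup>2"
          using p by (simp add: field_simps power2_eq_square)
        show "0 \<le> u s" using nonneg \<open>0 < s\<close> by simp
      qed
      also note IH
      finally show ?thesis .
    qed
  qed
  have lim: "(\<lambda>n. p ^ Suc n * x) \<longlonglongrightarrow> 0" for x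
    using p by (intro tendsto_mult_left_zero LIMSEQ_Suc LIMSEQ_power_zero) auto
  \<comment> \<open>On either side of 1, the larger of \<open>u t\<close> and
    \<open>t^2 * u t\<close> is at most \<open>B\<close>, so their sum is at most
    \<open>2 * B\<close>.\<close>
  have "u t \<le> 2 * B * inverse (1 + t\<^sup>2)" if "0 < t" for t
  proof (cases "t \<le> 1")
    case True
    have "\<exists>n. p ^ Suc n * 1 < t"
      using order_tendstoD(2)[OF lim[of 1] that] by (auto simp: eventually_sequentially)
    then have "u t \<le> B"
      using small True by (metis less_imp_le mult.right_neutral)
    moreover have "t\<^sup>2 * u t \<le> 1 * u t"
      using True that nonneg[OF that] by (intro mult_right_mono power_le_one) auto
    ultimately have "(1 + t\<^sup>2) * u t \<le> 2 * B"
      by (simp add: algebra_simps)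
    moreover have "0 < 1 + t\<^sup>2" by (simp add: add_pos_nonneg)
    ultimately show ?thesis by (simp add: field_simps)
  next
    case False
    have "\<exists>n. p ^ Suc n * t < 1"
      using order_tendstoD(2)[OF lim[of t], of 1] by (auto simp: eventually_sequentially)
    then have "t\<^sup>2 * u t \<le> B"
      using large False by (metis less_imp_le not_le)
    moreover have "1 * u t \<le> t\<^sup>2 * u t"
      using False that nonneg[OF that] by (intro mult_right_mono one_le_power) auto
    ultimately have "(1 + t\<^sup>2) * u t \<le> 2 * B"
      by (simp add: algebra_simps)
    moreover have "0 < 1 + t\<^sup>2" by (simp add: add_pos_nonneg)
    ultimately show ?thesis by (simp add: field_simps)
  qed
  then show ?thesis by blast
qed

section \<open>Integrability of 1 / theta and termwise integration\<close>

context q_base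
begin

lemma ray_regular:
  assumes "d \<in> {-pi<..<pi}" "0 \<le> t"
  shows "1 + of_real t * cis d \<noteq> 0"
  using cis_plus_one_lower_bound[OF assms(1)] assms(2) by (metis norm_zero not_le)

lemma theta_ray_nz:
  assumes "d \<in> {-pi<..<pi}" "0 < t"
  shows "theta p (of_real t * cis d) \<noteq> 0"
proof (rule theta_nz)
  show "of_real t * cis d \<noteq> 0" using assms(2) by simp
  show "of_real (p powi m) * (of_real t * cis d) \<noteq> - 1" for m
  proof
    assume "of_real (p powi m) * (of_real t * cis d) = - 1"
    then have "1 + of_real (p powi m * t) * cis d = 0"
      by (simp add: mult.assoc)
    moreover have "0 \<le> p powi m * t"
      using assms(2) p_pos by simp
    ultimately show False
      using ray_regular[OF assms(1)] by blast
  qed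
qed

text \<open>\<open>theta_scale\<close> with \<open>m = 1\<close> is the functional equation of
  \<open>rescaling_decay\<close> for the norm of \<open>1 / theta\<close>, which gives the
  integrable majorant \<open>M / (1 + t^2)\<close>.\<close>

lemma integrable_inverse_theta:
  assumes d: "d \<in> {-pi<..<pi}"
  shows "integrable lborel (\<lambda>t. indicator {0<..} t *\<^sub>R (1 / theta p (of_real t * cis d)))"
proof -
  let ?f = "\<lambda>t. 1 / theta p (of_real t * cis d)"
  have cont: "continuous_on {0<..} ?f"
    using theta_ray_nz[OF d]
    by (intro continuous_intros continuous_on_compose2[OF continuous_on_theta]) auto
  have "\<exists>M. \<forall>t>0. norm (?f t) \<le> M * inverse (1 + t\<^sup>2)"
  proof (rule rescaling_decay[OF p_pos p_less_1])
    show "continuous_on {0<..} (\<lambda>t. norm (?f t))"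
      by (intro continuous_on_norm cont)
    show "norm (?f (p * t)) = t * norm (?f t)" if "0 < t" for t
    proof -
      have "theta p (of_real t * cis d) = of_real t * cis d * theta p (of_real (p * t) * cis d)"
        using theta_scale[of "of_real t * cis d" 1] that by (simp add: mult.assoc)
      then show ?thesis
        using that by (simp add: norm_divide norm_mult)
    qed
  qed simp
  then obtain M where M: "\<And>t. 0 < t \<Longrightarrow> norm (?f t) \<le> M * inverse (1 + t\<^sup>2)"
    by blast
  show ?thesis
  proof (rule Bochner_Integration.integrable_bound)
    show "integrable lborel (\<lambda>t :: real. M * inverse (1 + t\<^sup>2))"
      using integrable_inverse_1_plus_square by (simp add: set_integrable_def)
    show "(\<lambda>t. indicator {0<..} t *\<^sub>R ?f t) \<in> borel_measurable lborel"
      using borel_measurable_continuous_on_indicator[OF _ cont] by simp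
    have "0 \<le> M * inverse (1 + 1\<^sup>2)"
      using order_trans[OF norm_ge_zero M[of 1]] by simp
    then have "0 \<le> M" by simp
    then have "norm (indicator {0<..} t *\<^sub>R ?f t) \<le> norm (M * inverse (1 + t\<^sup>2))" for t
      using M[of t] by (auto simp: indicator_def)
    then show "AE t in lborel. norm (indicator {0<..} t *\<^sub>R ?f t) \<le> norm (M * inverse (1 + t\<^sup>2))"
      by simp
  qed
qed


text \<open>The continuous counterpart of \<open>discrete_sums_eq\<close>, with a change of
  variables in place of the index shift. Two angles occur: \<open>d\<close> is the direction of the
  ray, \<open>\<alpha>\<close> that of the argument of theta.\<close>

lemma ray_integrals_eq:
  assumes d: "d \<in> {-pi<..<pi}" and \<alpha>: "\<alpha> \<in> {-pi<..<pi}" and \<kappa>: "0 < \<kappa>"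
  shows "of_real (1 - p) * (LINT t:{0<..}|lborel. psi (of_real t * cis d) / eul (of_real ((1 - p) * \<kappa> * t) * cis \<alpha>) * cis d) =
    (LINT t:{0<..}|lborel. poch_inf * psi_series (of_real (t / (1 - p)) * cis d) / theta p (of_real (\<kappa> * t) * cis \<alpha>) * cis d)"
proof -
  define G where "G = (\<lambda>t :: real. indicator {0<..} t *\<^sub>R (cis d / theta p (of_real (\<kappa> * t) * cis \<alpha>)))"
  define h where "h = (\<lambda>t :: real. indicator {0<..} t *\<^sub>R psi (of_real t * cis d))"
  \<comment> \<open>\<open>f m\<close> is the m-th term of the theta integrand without
    \<open>poch_inf\<close>; \<open>g m\<close> arises from it by the substitution of
    \<open>(1 - p) t / p^m\<close> for \<open>t\<close>, divided by \<open>p^m\<close>. Extension by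
    0 to the whole line allows the affine substitution rule.\<close>
  define f where "f = (\<lambda>m t. of_real (p ^ m / poch m) * h (p ^ m * t / (1 - p)) * G t)"
  define g where "g = (\<lambda>m t. of_real (1 / poch m) * h t * G ((1 - p) / p ^ m * t))"
  obtain c where c: "0 < c" "\<And>t. 0 \<le> t \<Longrightarrow> c \<le> norm (1 + of_real t * cis d)"
    using cis_plus_one_lower_bound[OF d] by blast
  have h_bound: "norm (h t) \<le> 1 / c" for t
  proof (cases "0 < t")
    case True
    then show ?thesis
      unfolding h_def psi_def using c by (simp add: norm_divide frac_le)
  qed (use c in \<open>simp add: h_def\<close>)
  have h_meas [measurable]: "h \<in> borel_measurable borel"
    unfolding h_def psi_def by measurable
  have "integrable lborel (\<lambda>t. cis d * (indicator {0<..} (0 + \<kappa> * t) *\<^sub>R (1 / theta p (of_real (0 + \<kappa> * t) * cis \<alpha>))))"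
    using lborel_integrable_real_affine[OF integrable_inverse_theta[OF \<alpha>], of \<kappa> 0] \<kappa>
    by (intro integrable_mult_right) simp
  also have "(\<lambda>t. cis d * (indicator {0<..} (0 + \<kappa> * t) *\<^sub>R (1 / theta p (of_real (0 + \<kappa> * t) * cis \<alpha>)))) = G"
    using \<kappa> by (auto simp: G_def fun_eq_iff indicator_def zero_less_mult_iff)
  finally have G: "integrable lborel G" .
  have w_nonneg: "0 \<le> p ^ m / poch m" for m
    using p_pos poch_pos[of m] by simp
  \<comment> \<open>As \<open>psi\<close> is bounded on the ray, \<open>f m\<close> is dominated by
    a summable weight times one integrable function.\<close>
  have f_bound: "norm (f m t) \<le> p ^ m / poch m * (1 / c * norm (G t))" for m t
    unfolding f_def norm_mult norm_of_real mult.assoc abs_of_nonneg[OF w_nonneg]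
    using w_nonneg[of m] by (intro mult_left_mono mult_right_mono h_bound) auto
  have f_int: "integrable lborel (f m)" for m
  proof (rule Bochner_Integration.integrable_bound)
    show "integrable lborel (\<lambda>t. p ^ m / poch m * (1 / c * norm (G t)))"
      using G by (intro integrable_mult_right integrable_norm)
    have "G \<in> borel_measurable lborel"
      using G by auto
    then show "f m \<in> borel_measurable lborel"
      unfolding f_def by measurable
    show "AE t in lborel. norm (f m t) \<le> norm (p ^ m / poch m * (1 / c * norm (G t)))"
      by (intro AE_I2 order_trans[OF f_bound]) (simp only: real_norm_def abs_ge_self)
  qed
  have f_sum: "summable (\<lambda>m. norm (f m t))" for t
    by (rule summable_comparison_test'[OF summable_mult2[OF summable_weights, of "1 / c * norm (G t)"], of 0])
      (simp only: real_norm_def abs_norm_cancel f_bound)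
  have f_norms: "summable (\<lambda>m. \<integral>t. norm (f m t) \<partial>lborel)"
  proof (rule summable_comparison_test'[OF summable_mult2[OF summable_weights], of 0])
    fix m
    have "(\<integral>t. norm (f m t) \<partial>lborel) \<le> (\<integral>t. p ^ m / poch m * (1 / c * norm (G t)) \<partial>lborel)"
      using G f_int f_bound by (intro integral_mono integrable_norm integrable_mult_right)
    then show "norm (\<integral>t. norm (f m t) \<partial>lborel) \<le> p ^ m / poch m * (1 / c * (\<integral>t. norm (G t) \<partial>lborel))"
      by simp
  qed
  have scale: "f m (0 + (1 - p) / p ^ m * t) = of_real (p ^ m) * g m t" for m t
    using p_less_1 by (simp add: f_def g_def)
  have fg: "g m = (\<lambda>t. of_real (1 / p ^ m) * f m (0 + (1 - p) / p ^ m * t))" for m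
    unfolding scale by (simp flip: of_real_mult mult.assoc)
  have nz: "(1 - p) / p ^ m \<noteq> 0" for m
    using p_less_1 by simp
  have g_int: "integrable lborel (g m)" for m
    unfolding fg by (intro integrable_mult_right lborel_integrable_real_affine f_int nz)
  have f_eq_g: "(\<integral>t. f m t \<partial>lborel) = of_real (1 - p) * (\<integral>t. g m t \<partial>lborel)" for m
  proof -
    have "(\<integral>t. f m t \<partial>lborel) = \<bar>(1 - p) / p ^ m\<bar> *\<^sub>R (\<integral>t. f m (0 + (1 - p) / p ^ m * t) \<partial>lborel)"
      by (rule lborel_integral_real_affine[OF nz])
    also have "\<dots> = of_real (1 - p) * (\<integral>t. g m t \<partial>lborel)"
      unfolding scale using p_pos p_less_1 by (simp add: scaleR_conv_of_real)
    finally show ?thesis .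
  qed
  \<comment> \<open>The weight \<open>p^m\<close> is absent from \<open>g m\<close>, so summability
    of its norm integrals is taken over from \<open>f m\<close>.\<close>
  have f_eq_g_norm: "(\<integral>t. norm (f m t) \<partial>lborel) = (1 - p) * (\<integral>t. norm (g m t) \<partial>lborel)" for m
  proof -
    have "(\<integral>t. norm (f m t) \<partial>lborel) = \<bar>(1 - p) / p ^ m\<bar> *\<^sub>R (\<integral>t. norm (f m (0 + (1 - p) / p ^ m * t)) \<partial>lborel)"
      by (rule lborel_integral_real_affine[OF nz])
    also have "\<dots> = (1 - p) * (\<integral>t. norm (g m t) \<partial>lborel)"
      unfolding scale norm_mult using p_pos p_less_1 by (simp add: norm_power)
    finally show ?thesis .
  qed
  have g_norms: "summable (\<lambda>m. \<integral>t. norm (g m t) \<partial>lborel)"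
    using f_norms p_less_1 unfolding f_eq_g_norm by simp
  have g_has_sum: "((\<lambda>m. g m t) has_sum
      indicator {0<..} t *\<^sub>R (psi (of_real t * cis d) / eul (of_real ((1 - p) * \<kappa> * t) * cis \<alpha>) * cis d / poch_inf)) UNIV" for t
  proof (cases "0 < t")
    case True
    let ?b = "of_real ((1 - p) * \<kappa> * t) * cis \<alpha>"
    have pos: "0 < (1 - p) * \<kappa> * t"
      using True \<kappa> p_less_1 by simp
    then have "theta p ?b \<noteq> 0" "?b \<noteq> 0"
      using theta_ray_nz[OF \<alpha> pos] by auto
    then have "((\<lambda>m. psi (of_real t * cis d) * cis d * (of_real (1 / poch m) / theta p (of_real (p powi (- int m)) * ?b))) has_sum
      psi (of_real t * cis d) * cis d * (1 / (poch_inf * eul ?b))) UNIV"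
      by (intro has_sum_cmult_right sum_inverse_theta)
    moreover have "psi (of_real t * cis d) * cis d * (of_real (1 / poch m) / theta p (of_real (p powi (- int m)) * ?b)) = g m t" for m
    proof -
      have b: "of_real (\<kappa> * ((1 - p) / p ^ m * t)) * cis \<alpha> = of_real (p powi (- int m)) * ?b"
        by (simp add: power_int_minus field_simps)
      show ?thesis
        unfolding g_def h_def G_def b using True p_pos p_less_1 by simp
    qed
    ultimately show ?thesis
      using True by (simp add: mult_ac)
  qed (simp add: g_def h_def)
  have g_summable: "summable (\<lambda>m. norm (g m t))" for t
    using has_sum_imp_summable[OF g_has_sum[of t]]
    by (intro summable_on_imp_summable) (simp only: summable_on_iff_abs_summable_on_complex)
  have g_suminf: "(\<Sum>m. g m t) =
      indicator {0<..} t *\<^sub>R (psi (of_real t * cis d) / eul (of_real ((1 - p) * \<kappa> * t) * cis \<alpha>) * cis d / poch_inf)" for t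
    by (rule sums_unique[symmetric, OF has_sum_imp_sums[OF g_has_sum]])
  have f_suminf: "(\<Sum>m. f m t) =
      indicator {0<..} t *\<^sub>R (psi_series (of_real (t / (1 - p)) * cis d) / theta p (of_real (\<kappa> * t) * cis \<alpha>) * cis d)" for t
  proof (cases "0 < t")
    case True
    let ?z = "of_real (t / (1 - p)) * cis d"
    have "1 + of_real (p ^ m) * ?z \<noteq> 0" for m
    proof -
      have "0 \<le> p ^ m * (t / (1 - p))"
        using True p_pos p_less_1 by simp
      from ray_regular[OF d this] show ?thesis
        by (simp add: mult.assoc)
    qed
    then have "?z \<in> psi_regular"
      by (simp add: psi_regular_def)
    then have "((\<lambda>m. of_real (p ^ m / poch m) * psi (of_real (p ^ m) * ?z) * (cis d / theta p (of_real (\<kappa> * t) * cis \<alpha>)))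
      has_sum psi_series ?z * (cis d / theta p (of_real (\<kappa> * t) * cis \<alpha>))) UNIV"
      by (intro has_sum_cmult_left psi_series_has_sum)
    moreover have "of_real (p ^ m / poch m) * psi (of_real (p ^ m) * ?z) * (cis d / theta p (of_real (\<kappa> * t) * cis \<alpha>)) = f m t" for m
    proof -
      have z: "of_real (p ^ m) * ?z = of_real (p ^ m * t / (1 - p)) * cis d"
        by simp
      show ?thesis
        unfolding f_def h_def G_def z using True p_pos p_less_1 by simp
    qed
    ultimately have "((\<lambda>m. f m t) has_sum psi_series ?z * (cis d / theta p (of_real (\<kappa> * t) * cis \<alpha>))) UNIV"
      by simp
    from sums_unique[OF has_sum_imp_sums[OF this]] show ?thesis
      using True by simp
  qed (simp add: f_def G_def)
  have "(\<lambda>m. \<integral>t. f m t \<partial>lborel) sums (\<integral>t. (\<Sum>m. f m t) \<partial>lborel)"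
    by (rule sums_integral[OF f_int AE_I2 f_norms]) (rule f_sum)
  moreover have "(\<lambda>m. \<integral>t. g m t \<partial>lborel) sums (\<integral>t. (\<Sum>m. g m t) \<partial>lborel)"
    by (rule sums_integral[OF g_int AE_I2 g_norms]) (rule g_summable)
  then have "(\<lambda>m. \<integral>t. f m t \<partial>lborel) sums (of_real (1 - p) * (\<integral>t. (\<Sum>m. g m t) \<partial>lborel))"
    unfolding f_eq_g by (rule sums_mult)
  ultimately have "of_real (1 - p) * (\<integral>t. (\<Sum>m. g m t) \<partial>lborel) = (\<integral>t. (\<Sum>m. f m t) \<partial>lborel)"
    by (rule sums_unique2[symmetric])
  then have main: "of_real (1 - p) * (LINT t:{0<..}|lborel. psi (of_real t * cis d) / eul (of_real ((1 - p) * \<kappa> * t) * cis \<alpha>) * cis d / poch_inf) =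
    (LINT t:{0<..}|lborel. psi_series (of_real (t / (1 - p)) * cis d) / theta p (of_real (\<kappa> * t) * cis \<alpha>) * cis d)"
    unfolding g_suminf f_suminf set_lebesgue_integral_def .
  have "(LINT t:{0<..}|lborel. psi (of_real t * cis d) / eul (of_real ((1 - p) * \<kappa> * t) * cis \<alpha>) * cis d / poch_inf) =
    (LINT t:{0<..}|lborel. psi (of_real t * cis d) / eul (of_real ((1 - p) * \<kappa> * t) * cis \<alpha>) * cis d) / poch_inf"
    by (rule set_integral_divide_zero)
  moreover have "(LINT t:{0<..}|lborel. poch_inf * psi_series (of_real (t / (1 - p)) * cis d) / theta p (of_real (\<kappa> * t) * cis \<alpha>) * cis d) =
    poch_inf * (LINT t:{0<..}|lborel. psi_series (of_real (t / (1 - p)) * cis d) / theta p (of_real (\<kappa> * t) * cis \<alpha>) * cis d)"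
    by (simp only: set_integral_mult_right[symmetric] times_divide_eq_left times_divide_eq_right mult.assoc)
  ultimately show ?thesis
    unfolding main[symmetric] by simp
qed

lemma Euler_dir_eq:
  assumes d: "d \<in> {-pi<..<pi}" and w: "Im w \<in> {d - pi<..<d + pi}"
  shows "Euler_exp_dir (1 / p) d (exp w) = Euler_theta_dir (1 / p) d (exp w)"
proof -
  \<comment> \<open>At \<open>t cis d\<close> on the ray, the quotient \<open>q \<xi> / x\<close>
    becomes \<open>\<kappa> t cis \<alpha>\<close>. The range allowed for \<open>Im w\<close> puts
    \<open>\<alpha>\<close> strictly between \<open>-pi\<close> and \<open>pi\<close>, so theta has
    no zero on this ray.\<close>
  define \<kappa> where "\<kappa> = exp (- Re w) / p"
  have \<kappa>: "0 < \<kappa>" using p_pos by (simp add: \<kappa>_def)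
  define \<alpha> where "\<alpha> = d - Im w"
  have \<alpha>: "\<alpha> \<in> {-pi<..<pi}" using w by (auto simp: \<alpha>_def)
  have "cis d / exp w = of_real (exp (- Re w)) * cis \<alpha>"
    by (simp add: exp_eq_polar \<alpha>_def cis_divide[symmetric] exp_minus divide_simps exp_of_real)
  moreover have "of_real (1 / p) * (of_real t * cis d) / exp w = of_real (1 / p * t) * (cis d / exp w)" for t
    by simp
  ultimately have arg: "of_real (1 / p) * (of_real t * cis d) / exp w = of_real (\<kappa> * t) * cis \<alpha>" for t
    by (simp add: \<kappa>_def mult_ac)
  have arg': "of_real (1 - p) * (of_real (\<kappa> * t) * cis \<alpha>) = of_real ((1 - p) * \<kappa> * t) * cis \<alpha>" for t
    by simp
  have phi: "phi (1 / p) (of_real t * cis d) = poch_inf * psi_series (of_real (t / (1 - p)) * cis d)" if "0 < t" for t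
  proof -
    have z: "of_real t * cis d / of_real (1 - p) = of_real (t / (1 - p)) * cis d"
      by simp
    have "1 + of_real (p ^ m) * (of_real (t / (1 - p)) * cis d) \<noteq> 0" for m
    proof -
      have "0 \<le> p ^ m * (t / (1 - p))"
        using that p_pos p_less_1 by simp
      from ray_regular[OF d this] show ?thesis
        by (simp add: mult.assoc)
    qed
    then have "of_real t * cis d \<notin> phi_poles (1 / p)"
      unfolding not_phi_poles_iff z by (simp add: psi_regular_def)
    from phi_eq[OF this] show ?thesis
      unfolding z .
  qed
  have inv: "1 / (1 / p) = p" by simp
  have exp_side: "Euler_exp_dir (1 / p) d (exp w) = of_real ((1 / p - 1) / ln (1 / p)) *
    (LINT t:{0<..}|lborel. psi (of_real t * cis d) / eul (of_real ((1 - p) * \<kappa> * t) * cis \<alpha>) * cis d)"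
    unfolding Euler_exp_dir_def ray_integral_def qexp_eq arg arg' ..
  have theta_side: "Euler_theta_dir (1 / p) d (exp w) = of_real (1 / p / ln (1 / p)) *
    (LINT t:{0<..}|lborel. poch_inf * psi_series (of_real (t / (1 - p)) * cis d) / theta p (of_real (\<kappa> * t) * cis \<alpha>) * cis d)"
    unfolding Euler_theta_dir_def ray_integral_def inv arg
    by (intro arg_cong2[where f = "(*)"] refl set_lebesgue_integral_cong) (auto simp: phi)
  \<comment> \<open>The prefactors \<open>q - 1\<close> and \<open>q\<close> differ by
    \<open>1 - p\<close>, the factor produced by the change of variables.\<close>
  have "(1 / p - 1) / ln (1 / p) = 1 / p / ln (1 / p) * (1 - p)"
    using p_pos by (simp add: diff_divide_distrib right_diff_distrib)
  then show ?thesis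
    unfolding exp_side theta_side ray_integrals_eq[OF d \<alpha> \<kappa>, symmetric]
    by (simp only: of_real_mult mult.assoc)
qed

end

section \<open>Transfer to base q\<close>

theorem theorem3p3:
  fixes q :: real
  assumes "q > 1"
  shows "(\<forall>w::complex. \<bar>Im w\<bar> < 2 * pi \<longrightarrow> Euler_exp q w = Euler_theta q w) \<and>
    (\<forall>l x::complex.
       l \<noteq> 0 \<and> l \<notin> {- of_real (q powi k) | k::int. True} \<and>
       x \<noteq> 0 \<and> x \<notin> {of_real (1/q - 1) * l * of_real (q powi k) | k::int. True} \<longrightarrow>
       Euler_exp_disc q l x = Euler_theta_disc q l x)"
proof (intro conjI allI impI)
  interpret q_base "1 / q"
    using assms by unfold_locales auto
  have q: "1 / (1 / q) = q" by simp
  fix w :: complex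
  have dir: "Euler_exp_dir q d (exp w) = Euler_theta_dir q d (exp w)"
    if "d \<in> {-pi<..<pi}" "Im w \<in> {d - pi<..<d + pi}" for d
    using Euler_dir_eq[OF that] unfolding q .
  show "Euler_exp q w = Euler_theta q w"
    \<comment> \<open>The directional functions agree wherever the gluing condition evaluates them,
      so both \<open>THE\<close> terms have the same defining predicate.\<close>
    unfolding Euler_exp_def Euler_theta_def glue_def
    by (intro arg_cong[where f = The] ext ball_cong refl imp_cong) (simp only: dir)
next
  interpret q_base "1 / q"
    using assms by unfold_locales auto
  have q: "1 / (1 / q) = q" by simp
  have powi: "(1 / q) powi k = q powi (- k)" for k
    by (simp add: power_int_minus power_int_divide_distrib divide_inverse power_int_inverse)
  fix l x :: complex
  assume *: "l \<noteq> 0 \<and> l \<notin> {- of_real (q powi k) | k::int. True} \<and>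
    x \<noteq> 0 \<and> x \<notin> {of_real (1/q - 1) * l * of_real (q powi k) | k::int. True}"
  show "Euler_exp_disc q l x = Euler_theta_disc q l x"
  proof (rule Euler_disc_eq[unfolded q])
    show "1 + of_real ((1 / q) powi k) * l \<noteq> 0" for k
    proof
      assume "1 + of_real ((1 / q) powi k) * l = 0"
      then have "l = - of_real (q powi k)"
        unfolding powi using assms by (simp add: power_int_minus field_simps add_eq_0_iff)
      with * show False by blast
    qed
    show "x \<noteq> - (of_real (1 - 1 / q) * l * of_real ((1 / q) powi k))" for k
    proof
      assume "x = - (of_real (1 - 1 / q) * l * of_real ((1 / q) powi k))"
      \<comment> \<open>The minus sign turns \<open>1 - 1/q\<close> into \<open>1/q - 1\<close>, and
        powers of \<open>1 / q\<close> are powers of \<open>q\<close> with negated exponent.\<close>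
      also have "\<dots> = of_real (1 / q - 1) * l * of_real (q powi (- k))"
        unfolding powi by (simp add: algebra_simps)
      finally show False using * by blast
    qed
  qed (use * in auto)
qed

end
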